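(* Let $S$ be a finite non-empty set of primes and let $G$ be a finite simple graph of order $k$ such that the complement $\overline{G}$ of $G$ has either at least three connected components, or two connected components of order $\geq 2$. If $$k>3\cdot 2^{16(|S|+1)},$$ then $G$ is not representable with $S$.
   Context: The order of a graph is its number of vertices, and $|S|$ is the cardinality of $S$. For a finite non-empty set $S$ of primes, $\mathbb{Z}_S$ is the ring of those rationals whose denominators (in lowest terms) are not divisible by primes outside $S$, and $\mathbb{Z}_S^*$ is its multiplicative group of invertible elements ($S$-units). For a subset $A$ of $\mathbb{Z}_S$, $\mathcal{G}_S(A)$ is the graph with vertex set $A$ in which two vertices $a,b\in A$ are joined by an edge if and only if $a-b\in\mathbb{Z}_S^*$. A finite graph $G$ is representable with $S$ if $G$ is isomorphic to $\mathcal{G}_S(A)$ for some finite $A\subseteq\mathbb{Z}_S$. *)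

theory Defs
  imports
    "Graph_Theory.Digraph_Isomorphism"
    "HOL-Computational_Algebra.Primes"
begin

(* A finite simple graph is a digraph satisfying the locale pair_graph: finite, loop-free, without
   parallel arcs and symmetric. An undirected edge {u, v} is the pair of arcs (u, v), (v, u). *)

definition complement_graph :: "'v pair_pre_digraph \<Rightarrow> 'v pair_pre_digraph" where
  "complement_graph G =
     \<lparr> pverts = pverts G,
       parcs = {(u, v). u \<in> pverts G \<and> v \<in> pverts G \<and> u \<noteq> v \<and> (u, v) \<notin> parcs G} \<rparr>"

(* The null graph is not connected in the library's sense, so every component has a vertex. *)
definition connected_components :: "('v, 'e) pre_digraph \<Rightarrow> ('v, 'e) pre_digraph set" where
  "connected_components G = {C. pre_digraph.max_subgraph G connected C}"

definition S_integers :: "nat set \<Rightarrow> rat set" where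
  "S_integers S = {x. \<forall>p. prime p \<and> int p dvd snd (quotient_of x) \<longrightarrow> p \<in> S}"

definition S_units :: "nat set \<Rightarrow> rat set" where
  "S_units S = {x \<in> S_integers S. \<exists>y \<in> S_integers S. x * y = 1}"

(* Loop-free because 0 is not a unit, symmetric because -1 is one. *)
definition S_graph :: "nat set \<Rightarrow> rat set \<Rightarrow> rat pair_pre_digraph" where
  "S_graph S A = \<lparr> pverts = A, parcs = {(a, b). a \<in> A \<and> b \<in> A \<and> a - b \<in> S_units S} \<rparr>"

definition representable_with :: "'v pair_pre_digraph \<Rightarrow> nat set \<Rightarrow> bool" where
  "representable_with G S \<longleftrightarrow>
     (\<exists>A. finite A \<and> A \<subseteq> S_integers S \<and> digraph_iso (with_proj G) (with_proj (S_graph S A)))"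

lemma pair_graph_complement_graph:
  assumes "pair_graph G"
  shows "pair_graph (complement_graph G)"
proof -
  interpret pair_graph G by fact
  have "parcs (complement_graph G) \<subseteq> pverts G \<times> pverts G"
    by (auto simp: complement_graph_def)
  then have "finite (parcs (complement_graph G))"
    by (rule finite_subset) (simp add: pair_finite_verts)
  moreover have "sym (parcs G)"
    using pair_sym_arcs by (simp add: symmetric_def)
  ultimately show ?thesis
    by unfold_locales
       (auto simp: complement_graph_def pair_finite_verts symmetric_def sym_def)
qed

lemma S_integers_uminus: "x \<in> S_integers S \<Longrightarrow> - x \<in> S_integers S"
  by (simp add: S_integers_def rat_uminus_code split: prod.splits)

lemma S_units_uminus: "x \<in> S_units S \<Longrightarrow> - x \<in> S_units S"
  unfolding S_units_def using S_integers_uminus by force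

lemma pair_graph_S_graph:
  assumes "finite A"
  shows "pair_graph (S_graph S A)"
proof -
  have "parcs (S_graph S A) \<subseteq> A \<times> A"
    by (auto simp: S_graph_def)
  then have "finite (parcs (S_graph S A))"
    by (rule finite_subset) (simp add: assms)
  moreover have "0 \<notin> S_units S"
    by (simp add: S_units_def)
  moreover have "a - b \<in> S_units S \<Longrightarrow> b - a \<in> S_units S" for a b
    using S_units_uminus[of "a - b" S] by simp
  ultimately show ?thesis
    using assms by unfold_locales (auto simp: S_graph_def symmetric_def sym_def)
qed

end

theory Submission
  imports Defs "HOL-Analysis.Henstock_Kurzweil_Integration"
begin

text \<open>
  Vertices in different components of the complement are adjacent. In a representation, every
  vertex \<open>v\<close> outside the components of two chosen vertices
  \<open>a \<noteq> b\<close> therefore gives an \<open>S\<close>-unit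
  \<open>x = \<phi> v - \<phi> a\<close> for which \<open>x - c\<close> is an
  \<open>S\<close>-unit too, where \<open>c = \<phi> b - \<phi> a\<close>. If this equation
  has at most \<open>N = 2 ^ (16 (|S| + 1))\<close> solutions, then three components give
  \<open>k \<le> 3 N\<close>, as every vertex lies outside two of them. In a component of order
  at least two, both \<open>a\<close> and \<open>b\<close> can be chosen, and two such components
  give \<open>k \<le> 2 N\<close>. So everything rests on bounding the number of solutions of
  an \<open>S\<close>-unit equation (\<open>card_S_unit_solutions_le\<close>).

  That bound comes from the hypergeometric method of Thue and Siegel, in the shape given to it by
  Evertse and by Beukers and Schlickewei. Clearing denominators turns a solution into positive
  coprime integers with \<open>a + b = c\<close> whose product is a fixed number
  \<open>m\<close>, prime to \<open>S\<close>, times a product of primes of \<open>S\<close>. Pade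
  approximation supplies, for every \<open>M\<close> and \<open>n = 2 M + 1\<close>, an
  identity \<open>a^n P + (-1)^M b^n Q = c^n R\<close> in which \<open>P\<close>,
  \<open>Q\<close>, \<open>R\<close> have only the size of \<open>c^M\<close>
  (\<open>pade_identity\<close>). For a second triple \<open>a' + b' = c'\<close> and odd
  \<open>M\<close>, the integer \<open>a' b^n Q + b' a^n P\<close> is positive and divisible
  by \<open>gcd a' (a^n)\<close>, \<open>gcd b' (b^n)\<close> and
  \<open>gcd c' (c^n)\<close>, so the product of these is bounded
  (\<open>gcd_product_le\<close>).

  Let \<open>h = log c\<close> and \<open>h' = log c'\<close>. Suppose that each prime of
  \<open>S\<close> divides the same entry of both triples, that the logarithmic sizes of its
  powers in them are in about the same proportion to \<open>h\<close> and \<open>h'\<close>, and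
  likewise for \<open>m\<close> and the archimedean place. All these sizes together amount to
  about \<open>3 h\<close>. Hence, if \<open>h'\<close> lies between \<open>n h\<close> and
  \<open>(n + 4) h\<close>, the gcds and the saving at the archimedean place account for about
  \<open>3 n h\<close>, while the integer above accounts for at most about
  \<open>h' + (n + M) h\<close>; as \<open>n\<close> is about \<open>2 M\<close>, this is
  impossible once \<open>M\<close> is large (\<open>height_bound\<close>). The same comparison
  with \<open>M = 0\<close> shows that distinct heights in such a class grow by a factor
  \<open>3/2\<close> (\<open>height_gap\<close>). So a class has at most eight members of large
  height; there are at most \<open>3^|S| 111^(|S| + 2)\<close> classes for each of six ways to
  order the triple, and the solutions of small height are integer pairs in a fixed box. All this
  is far below \<open>N\<close>.
\<close>

section \<open>Pade approximation\<close>

lemma has_integral_beta_nat: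
  fixes p q :: real
  assumes "p \<le> q"
  shows "((\<lambda>t. (t - p) ^ k * (q - t) ^ l) has_integral
           (q - p) ^ (k + l + 1) * (fact k * fact l / fact (k + l + 1))) {p..q}"
proof (induction l arbitrary: k)
  case 0
  have k: "y ^ k + real k * y ^ (k - Suc 0) * y = real (Suc k) * y ^ k" for y :: real
    by (cases k) (auto simp: algebra_simps)
  have "((\<lambda>t. (t - p) ^ k) has_integral
          (q - p) ^ Suc k / real (Suc k) - (p - p) ^ Suc k / real (Suc k)) {p..q}"
    by (rule fundamental_theorem_of_calculus[OF assms])
       (auto intro!: derivative_eq_intros simp: has_real_derivative_iff_has_vector_derivative[symmetric] k simp del: of_nat_Suc)
  moreover have "(q - p) ^ (k + 0 + 1) * (fact k * fact 0 / fact (k + 0 + 1)) =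
      (q - p) ^ Suc k / real (Suc k)"
    by (simp del: of_nat_Suc)
  ultimately show ?case by (simp del: of_nat_Suc fact_Suc power_Suc)
next
  case (Suc l)
  let ?I = "(q - p) ^ (Suc k + l + 1) * (fact (Suc k) * fact l / fact (Suc k + l + 1))"
  have "((\<lambda>t. real (Suc k) * ((t - p) ^ k * (q - t) ^ Suc l) -
              real (Suc l) * ((t - p) ^ Suc k * (q - t) ^ l)) has_integral
          (q - p) ^ Suc k * (q - q) ^ Suc l - (p - p) ^ Suc k * (q - p) ^ Suc l) {p..q}"
    by (rule fundamental_theorem_of_calculus[OF assms])
       (auto intro!: derivative_eq_intros simp: has_real_derivative_iff_has_vector_derivative[symmetric] algebra_simps simp del: of_nat_Suc power_Suc)
  from has_integral_add[OF this has_integral_mult_right[OF Suc.IH[of "Suc k"], of "real (Suc l)"]]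
  have "((\<lambda>t. real (Suc k) * ((t - p) ^ k * (q - t) ^ Suc l)) has_integral real (Suc l) * ?I) {p..q}"
    by (simp del: of_nat_Suc)
  from has_integral_mult_right[OF this, of "1 / real (Suc k)"]
  have "((\<lambda>t. (t - p) ^ k * (q - t) ^ Suc l) has_integral
          1 / real (Suc k) * (real (Suc l) * ?I)) {p..q}"
    by (simp del: of_nat_Suc power_Suc fact_Suc)
  also have "1 / real (Suc k) * (real (Suc l) * ?I) =
      (q - p) ^ (k + Suc l + 1) * (fact k * fact (Suc l) / fact (k + Suc l + 1))"
    by (simp add: fact_Suc[of k] fact_Suc[of l] del: of_nat_Suc fact_Suc)
  finally show ?case .
qed

text \<open>
  Homogeneous form of the hypergeometric polynomial that occurs in the Pade approximants to
  \<open>(1 - z)^(2 M + 1)\<close>.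
\<close>
definition pade :: "nat \<Rightarrow> 'a::comm_ring_1 \<Rightarrow> 'a \<Rightarrow> 'a" where
  "pade M u v = (\<Sum>j\<le>M. of_nat ((M + j choose M) * (2 * M - j choose M)) * u ^ (M - j) * v ^ j)"

text \<open>
  The linear function \<open>g\<close> has the values \<open>u\<close> and \<open>v\<close> at the
  ends of the interval. Expanding its \<open>M\<close>-th power binomially leaves beta integrals,
  and the factorials combine to the integer coefficients of \<open>pade\<close>.
\<close>
lemma has_integral_pade:
  fixes p q u v :: real
  assumes "p < q" and g: "\<And>t. (q - p) * g t = u * (q - t) + v * (t - p)"
  shows "((\<lambda>t. (t - p) ^ M * (q - t) ^ M * g t ^ M) has_integral
           (q - p) ^ (2 * M + 1) * (fact M ^ 3 / fact (3 * M + 1)) * pade M u v) {p..q}"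
proof -
  let ?w = "\<lambda>j. real (M choose j) * v ^ j * u ^ (M - j)"
  have "((\<lambda>t. \<Sum>j\<le>M. ?w j * ((t - p) ^ (M + j) * (q - t) ^ (2 * M - j))) has_integral
         (\<Sum>j\<le>M. ?w j * ((q - p) ^ (3 * M + 1) * (fact (M + j) * fact (2 * M - j) / fact (3 * M + 1))))) {p..q}"
  proof (intro has_integral_sum has_integral_mult_right)
    fix j assume "j \<in> {..M}"
    then have "M + j + (2 * M - j) + 1 = 3 * M + 1" by auto
    with has_integral_beta_nat[of p q "M + j" "2 * M - j"] \<open>p < q\<close>
    show "((\<lambda>t. (t - p) ^ (M + j) * (q - t) ^ (2 * M - j)) has_integral
         (q - p) ^ (3 * M + 1) * (fact (M + j) * fact (2 * M - j) / fact (3 * M + 1))) {p..q}"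
      by simp
  qed simp
  also have "(\<lambda>t. \<Sum>j\<le>M. ?w j * ((t - p) ^ (M + j) * (q - t) ^ (2 * M - j))) =
     (\<lambda>t. (q - p) ^ M * ((t - p) ^ M * (q - t) ^ M * g t ^ M))"
  proof
    fix t
    have "(q - p) ^ M * g t ^ M = (v * (t - p) + u * (q - t)) ^ M"
      using g[of t] by (metis power_mult_distrib add.commute)
    also have "\<dots> = (\<Sum>j\<le>M. real (M choose j) * (v * (t - p)) ^ j * (u * (q - t)) ^ (M - j))"
      by (rule binomial_ring)
    finally have eq: "(q - p) ^ M * g t ^ M = \<dots>" .
    have "(q - p) ^ M * ((t - p) ^ M * (q - t) ^ M * g t ^ M) =
       ((t - p) ^ M * (q - t) ^ M) * ((q - p) ^ M * g t ^ M)"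
      by (simp only: mult_ac)
    also have "\<dots> =
       (\<Sum>j\<le>M. ((t - p) ^ M * (q - t) ^ M) * (real (M choose j) * (v * (t - p)) ^ j * (u * (q - t)) ^ (M - j)))"
      by (simp only: eq sum_distrib_left)
    also have "\<dots> = (\<Sum>j\<le>M. ?w j * ((t - p) ^ (M + j) * (q - t) ^ (2 * M - j)))"
    proof (rule sum.cong[OF refl])
      fix j assume "j \<in> {..M}"
      then have e: "2 * M - j = M + (M - j)" by auto
      show "((t - p) ^ M * (q - t) ^ M) * (real (M choose j) * (v * (t - p)) ^ j * (u * (q - t)) ^ (M - j))
         = ?w j * ((t - p) ^ (M + j) * (q - t) ^ (2 * M - j))"
        unfolding e power_add power_mult_distrib by (simp only: mult_ac)
    qed
    finally show "(\<Sum>j\<le>M. ?w j * ((t - p) ^ (M + j) * (q - t) ^ (2 * M - j))) =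
      (q - p) ^ M * ((t - p) ^ M * (q - t) ^ M * g t ^ M)" by simp
  qed
  also have "(\<Sum>j\<le>M. ?w j * ((q - p) ^ (3 * M + 1) * (fact (M + j) * fact (2 * M - j) / fact (3 * M + 1)))) =
      (q - p) ^ M * ((q - p) ^ (2 * M + 1) * (fact M ^ 3 / fact (3 * M + 1)) * pade M u v)"
    unfolding pade_def sum_distrib_left
  proof (rule sum.cong[OF refl])
    fix j assume "j \<in> {..M}"
    then have j: "j \<le> M" by simp
    have 1: "real (M choose j) = fact M / (fact j * fact (M - j))"
      using j by (rule binomial_fact)
    have 2: "real (M + j choose M) = fact (M + j) / (fact M * fact j)"
      by (subst binomial_fact) auto
    have 3: "real (2 * M - j choose M) = fact (2 * M - j) / (fact M * fact (M - j))"
      using j by (subst binomial_fact) (auto intro!: arg_cong[where f=fact])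
    have e: "3 * M + 1 = M + (2 * M + 1)" by simp
    have "(q - p) ^ (3 * M + 1) = (q - p) ^ M * (q - p) ^ (2 * M + 1)"
      unfolding e power_add ..
    note E = this
    show "?w j * ((q - p) ^ (3 * M + 1) * (fact (M + j) * fact (2 * M - j) / fact (3 * M + 1))) =
      (q - p) ^ M * ((q - p) ^ (2 * M + 1) * (fact M ^ 3 / fact (3 * M + 1)) *
         (of_nat ((M + j choose M) * (2 * M - j choose M)) * u ^ (M - j) * v ^ j))"
      unfolding of_nat_mult 1 2 3 E by (simp add: power3_eq_cube mult_ac del: One_nat_def)
  qed
  finally have "((\<lambda>t. (q - p) ^ M * ((t - p) ^ M * (q - t) ^ M * g t ^ M)) has_integral
    (q - p) ^ M * ((q - p) ^ (2 * M + 1) * (fact M ^ 3 / fact (3 * M + 1)) * pade M u v)) {p..q}" .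
  from has_integral_mult_right[OF this, of "inverse ((q - p) ^ M)"] \<open>p < q\<close> show ?thesis
    by (simp add: mult.assoc[symmetric] del: mult.assoc)
qed

text \<open>
  All three terms are, up to one common factor, integrals of
  \<open>t^M (a - t)^M (c - t)^M\<close>: over \<open>[0, a]\<close>, over
  \<open>[a, c]\<close> and over \<open>[0, c]\<close>. On each of these intervals two of the
  factors vanish at the ends, which produces the power \<open>2 M + 1\<close> of its length.
\<close>
lemma pade_identity_real:
  fixes a b c :: real
  assumes "a > 0" "b > 0" "c = a + b"
  shows "a ^ (2 * M + 1) * pade M c b + (-1) ^ M * (b ^ (2 * M + 1) * pade M a c) =
         c ^ (2 * M + 1) * pade M a (- b)"
proof -
  let ?F = "fact M ^ 3 / fact (3 * M + 1) :: real"
  let ?f = "\<lambda>t. t ^ M * (a - t) ^ M * (c - t) ^ M"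
  have 1: "(?f has_integral a ^ (2 * M + 1) * ?F * pade M c b) {0..a}"
    using has_integral_pade[of 0 a "\<lambda>t. c - t" c b M] assms by (simp add: algebra_simps)
  have 2: "((\<lambda>t. (t - a) ^ M * (c - t) ^ M * t ^ M) has_integral b ^ (2 * M + 1) * ?F * pade M a c) {a..c}"
    using has_integral_pade[of a c "\<lambda>t. t" a c M] assms by (simp add: algebra_simps)
  have "(\<lambda>t. (-1) ^ M * ((t - a) ^ M * (c - t) ^ M * t ^ M)) = ?f"
    by (simp add: fun_eq_iff power_mult_distrib[symmetric] algebra_simps)
  with has_integral_mult_right[OF 2, of "(-1) ^ M"]
  have 2: "(?f has_integral (-1) ^ M * (b ^ (2 * M + 1) * ?F * pade M a c)) {a..c}"
    by simp
  have 3: "((\<lambda>t. t ^ M * (c - t) ^ M * (a - t) ^ M) has_integral c ^ (2 * M + 1) * ?F * pade M a (- b)) {0..c}"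
    using has_integral_pade[of 0 c "\<lambda>t. a - t" a "- b" M] assms by (simp add: algebra_simps)
  have 3: "(?f has_integral c ^ (2 * M + 1) * ?F * pade M a (- b)) {0..c}"
    using 3 by (simp add: mult_ac)
  have "a ^ (2 * M + 1) * ?F * pade M c b + (-1) ^ M * (b ^ (2 * M + 1) * ?F * pade M a c) =
        c ^ (2 * M + 1) * ?F * pade M a (- b)"
    using has_integral_combine[OF _ _ 1 2] 3 assms by (intro has_integral_unique[OF _ 3]) auto
  then have "?F * (a ^ (2 * M + 1) * pade M c b + (-1) ^ M * (b ^ (2 * M + 1) * pade M a c)) =
        ?F * (c ^ (2 * M + 1) * pade M a (- b))"
    by (simp only: distrib_left mult_ac)
  then show ?thesis by simp
qed

lemma of_int_pade: "of_int (pade M u v) = pade M (of_int u) (of_int v)"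
  by (simp add: pade_def)

lemma pade_identity:
  fixes a b c :: int
  assumes "a > 0" "b > 0" "c = a + b"
  shows "a ^ (2 * M + 1) * pade M c b + (-1) ^ M * (b ^ (2 * M + 1) * pade M a c) =
         c ^ (2 * M + 1) * pade M a (- b)"
proof -
  have "real_of_int (a ^ (2 * M + 1) * pade M c b + (-1) ^ M * (b ^ (2 * M + 1) * pade M a c)) =
         real_of_int (c ^ (2 * M + 1) * pade M a (- b))"
    using pade_identity_real[of "of_int a" "of_int b" "of_int c" M] assms
    by (simp add: of_int_pade)
  then show ?thesis by (simp only: of_int_eq_iff)
qed

lemma pade_pos: "u > 0 \<Longrightarrow> v > 0 \<Longrightarrow> pade M u (v::int) > 0"
  unfolding pade_def by (intro sum_pos) auto

lemma pade_le:
  fixes u v w :: int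
  assumes "0 < u" "u \<le> w" "0 < v" "v \<le> w"
  shows "pade M u v \<le> int ((M + 1) * 8 ^ M) * w ^ M"
proof -
  have "of_nat ((M + j choose M) * (2 * M - j choose M)) * u ^ (M - j) * v ^ j \<le> 8 ^ M * w ^ M"
    if j: "j \<le> M" for j
  proof -
    have "(M + j choose M) * (2 * M - j choose M) \<le> 2 ^ (M + j) * 2 ^ (2 * M - j)"
      by (intro mult_mono binomial_le_pow2) auto
    also have "\<dots> = 2 ^ (3 * M)"
      using j by (simp add: power_add[symmetric])
    also have "\<dots> = 8 ^ M" by (simp add: power_mult)
    finally have 1: "int ((M + j choose M) * (2 * M - j choose M)) \<le> 8 ^ M"
      by (metis of_nat_le_iff of_nat_numeral of_nat_power)
    have "u ^ (M - j) * v ^ j \<le> w ^ (M - j) * w ^ j"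
      using assms by (intro mult_mono power_mono) auto
    also have "\<dots> = w ^ M" using j by (simp add: power_add[symmetric])
    finally have 2: "u ^ (M - j) * v ^ j \<le> w ^ M" .
    show ?thesis unfolding mult.assoc
      using mult_mono[OF 1 2] assms by (simp add: mult.assoc)
  qed
  then have "pade M u v \<le> (\<Sum>j\<le>M. 8 ^ M * w ^ M)"
    unfolding pade_def by (intro sum_mono) auto
  then show ?thesis by (simp add: algebra_simps)
qed

lemma coprime_add_self:
  fixes a b :: int
  assumes "coprime a b"
  shows "coprime a (a + b)" "coprime b (a + b)"
  using assms by (metis coprime_iff_gcd_eq_1 gcd.commute gcd_add1 gcd_add2 add.commute)+

section \<open>Two triples and the determinant of an approximation\<close>

text \<open>
  The bounded integer is the determinant that tests whether the vectors \<open>(a', b')\<close>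
  and \<open>(a^n P, - b^n Q)\<close> are parallel. For odd \<open>M\<close> the minus sign
  makes it a sum of positive terms, so that it does not vanish. The identity for
  \<open>c^n R\<close> shows that it treats the third entry like the first two.
\<close>
lemma gcd_product_le:
  fixes a b c a' b' c' :: int
  assumes pos: "a > 0" "b > 0" "a' > 0" "b' > 0" and sums: "c = a + b" "c' = a' + b'"
    and cop: "coprime a' b'" and "odd M" and n: "n = 2 * M + 1"
  shows "gcd a' (a ^ n) * gcd b' (b ^ n) * gcd c' (c ^ n) \<le>
         int ((M + 1) * 8 ^ M) * c ^ M * (a' * c ^ n + c' * a ^ n)"
proof -
  define P where "P = pade M c b"
  define Q where "Q = pade M a c"
  define R where "R = pade M a (- b)"
  have id: "a ^ n * P - b ^ n * Q = c ^ n * R"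
    using pade_identity[of a b c M] assms by (simp add: P_def Q_def R_def n)
  define D where "D = a' * (b ^ n * Q) + b' * (a ^ n * P)"
  have PQ: "P > 0" "Q > 0" using pos sums by (auto simp: P_def Q_def pade_pos)
  have "D > 0" using PQ pos by (simp add: D_def add_pos_pos)
  have D': "D = c' * (a ^ n * P) - a' * (c ^ n * R)"
    unfolding D_def id[symmetric] sums(2) by (simp only: algebra_simps)
  have "gcd a' (a ^ n) dvd D" "gcd b' (b ^ n) dvd D" unfolding D_def
    by (meson dvd_add dvd_mult dvd_mult2 gcd_dvd1 gcd_dvd2)+
  moreover have "gcd c' (c ^ n) dvd D" unfolding D'
    by (meson dvd_diff dvd_mult dvd_mult2 gcd_dvd1 gcd_dvd2)
  moreover have cop': "coprime a' c'" "coprime b' c'"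
    using coprime_add_self[OF cop] sums by simp_all
  then have "coprime (gcd a' (a ^ n)) (gcd b' (b ^ n))" "coprime (gcd a' (a ^ n) * gcd b' (b ^ n)) (gcd c' (c ^ n))"
    using cop by (auto intro!: coprime_mult_left_iff[THEN iffD2] intro: coprime_divisors)
  ultimately have "gcd a' (a ^ n) * gcd b' (b ^ n) * gcd c' (c ^ n) dvd D"
    by (intro divides_mult) auto
  then have "gcd a' (a ^ n) * gcd b' (b ^ n) * gcd c' (c ^ n) \<le> D"
    using \<open>D > 0\<close> by (rule zdvd_imp_le)
  also have "D \<le> a' * (c ^ n * (int ((M + 1) * 8 ^ M) * c ^ M)) + c' * (a ^ n * (int ((M + 1) * 8 ^ M) * c ^ M))"
    unfolding D_def P_def Q_def using pos sums
    by (intro add_mono mult_mono power_mono pade_le) (auto intro!: mult_nonneg_nonneg less_imp_le[OF pade_pos])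
  finally show ?thesis by (simp add: algebra_simps)
qed

text \<open>
  The case \<open>M = 0\<close>, in which \<open>P\<close>, \<open>Q\<close> and
  \<open>R\<close> are \<open>1\<close>. The determinant is now a difference, and it is
  coprimality that keeps it from vanishing.
\<close>
lemma gcd_product_le_distinct:
  fixes a b c a' b' c' :: int
  assumes pos: "a > 0" "b > 0" "a' > 0" "b' > 0" and sums: "c = a + b" "c' = a' + b'"
    and cop: "coprime a b" "coprime a' b'" and neq: "(a, b) \<noteq> (a', b')"
  shows "gcd a' a * gcd b' b * gcd c' c \<le> max (a' * c) (c' * a)"
proof -
  define D where "D = a' * b - b' * a"
  have "D \<noteq> 0"
  proof
    assume "D = 0"
    then have e: "a' * b = b' * a" by (simp add: D_def)
    then have "a' dvd a" using cop by (metis coprime_dvd_mult_right_iff dvd_triv_left)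
    moreover have "a dvd a'" using cop e by (metis coprime_dvd_mult_left_iff dvd_triv_right)
    ultimately have "a = a'" using pos by (simp add: zdvd_antisym_nonneg)
    then show False using e pos neq by simp
  qed
  have D': "D = a' * c - c' * a" by (simp add: D_def sums algebra_simps)
  have "gcd a' a dvd D" "gcd b' b dvd D" unfolding D_def
    by (meson dvd_diff dvd_mult dvd_mult2 gcd_dvd1 gcd_dvd2)+
  moreover have "gcd c' c dvd D" unfolding D'
    by (meson dvd_diff dvd_mult dvd_mult2 gcd_dvd1 gcd_dvd2)
  moreover have cop': "coprime a' c'" "coprime b' c'"
    using coprime_add_self[OF cop(2)] sums by simp_all
  then have "coprime (gcd a' a) (gcd b' b)" "coprime (gcd a' a * gcd b' b) (gcd c' c)"
    using cop by (auto intro!: coprime_mult_left_iff[THEN iffD2] intro: coprime_divisors)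
  ultimately have "gcd a' a * gcd b' b * gcd c' c dvd D"
    by (intro divides_mult) auto
  then have "gcd a' a * gcd b' b * gcd c' c \<le> \<bar>D\<bar>"
    using \<open>D \<noteq> 0\<close> by (intro zdvd_imp_le) auto
  also have "\<bar>D\<bar> \<le> max (a' * c) (c' * a)"
    using pos sums by (auto simp: D' abs_if max_def not_less intro: order.trans mult_nonneg_nonneg)
  finally show ?thesis .
qed

definition gcd_product :: "nat \<Rightarrow> nat \<times> nat \<Rightarrow> nat \<times> nat \<Rightarrow> nat" where
  "gcd_product n = (\<lambda>(a, b) (a', b'). gcd a' (a ^ n) * gcd b' (b ^ n) * gcd (a' + b') ((a + b) ^ n))"

text \<open>
  A pair \<open>(a, b)\<close> stands for the triple \<open>a + b = c\<close>. The order of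
  \<open>a\<close> and \<open>b\<close> is fixed because the smallest entry plays the role of the
  entry that the archimedean place divides.
\<close>
definition sum_pair :: "nat \<times> nat \<Rightarrow> bool" where
  "sum_pair = (\<lambda>(a, b). 0 < a \<and> a \<le> b \<and> coprime a b)"

lemma gcd_product_le_nat:
  assumes "sum_pair (a, b)" "sum_pair (a', b')" "odd M"
  shows "gcd_product (2 * M + 1) (a, b) (a', b') \<le>
     (M + 1) * 8 ^ M * (a + b) ^ M * (a' * (a + b) ^ (2 * M + 1) + (a' + b') * a ^ (2 * M + 1))"
proof -
  have "b > 0" "b' > 0" using assms by (auto simp: sum_pair_def)
  then have "int (gcd_product (2 * M + 1) (a, b) (a', b')) \<le>
     int ((M + 1) * 8 ^ M * (a + b) ^ M * (a' * (a + b) ^ (2 * M + 1) + (a' + b') * a ^ (2 * M + 1)))"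
    using gcd_product_le[of "int a" "int b" "int a'" "int b'" "int (a + b)" "int (a' + b')" M, OF _ _ _ _ _ _ _ _ refl] assms
    by (simp only: gcd_product_def prod.case of_nat_mult of_nat_add of_nat_power gcd_int_int_eq[symmetric]
        sum_pair_def of_nat_0_less_iff coprime_int_iff simp_thms if_True)
  then show ?thesis by (simp only: of_nat_le_iff)
qed

lemma gcd_product_le_distinct_nat:
  assumes "sum_pair (a, b)" "sum_pair (a', b')" "(a, b) \<noteq> (a', b')"
  shows "gcd_product 1 (a, b) (a', b') \<le> max (a' * (a + b)) ((a' + b') * a)"
proof -
  have "b > 0" "b' > 0" using assms by (auto simp: sum_pair_def)
  then have "int (gcd_product 1 (a, b) (a', b')) \<le> int (max (a' * (a + b)) ((a' + b') * a))"
    using gcd_product_le_distinct[of "int a" "int b" "int a'" "int b'" "int (a + b)" "int (a' + b')"] assms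
    by (simp only: gcd_product_def prod.case of_nat_mult of_nat_add of_nat_max gcd_int_int_eq[symmetric]
        sum_pair_def of_nat_0_less_iff coprime_int_iff simp_thms power_one_right prod.inject of_nat_eq_iff)
  then show ?thesis by (simp only: of_nat_le_iff)
qed

section \<open>Valuations and heights\<close>

definition abc_product :: "nat \<times> nat \<Rightarrow> nat" where
  "abc_product = (\<lambda>(a, b). a * b * (a + b))"

text \<open>
  The position of the entry that \<open>p\<close> divides. The value \<open>2\<close> is also
  given to primes that divide no entry.
\<close>
definition place_type :: "nat \<times> nat \<Rightarrow> nat \<Rightarrow> nat" where
  "place_type = (\<lambda>(a, b) p. if p dvd a then 0 else if p dvd b then 1 else 2)"

lemma prod_coprime_dvd:
  fixes f :: "'i \<Rightarrow> nat"
  assumes "finite I" "\<And>i. i \<in> I \<Longrightarrow> f i dvd m"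
    and "\<And>i j. i \<in> I \<Longrightarrow> j \<in> I \<Longrightarrow> i \<noteq> j \<Longrightarrow> coprime (f i) (f j)"
  shows "prod f I dvd m"
  using assms
proof (induction I)
  case (insert i I)
  have "coprime (f i) (prod f I)"
    using insert by (intro prod_coprime_right) auto
  with insert show ?case by (auto intro!: divides_mult)
qed simp

lemma prime_power_dvd_gcd:
  fixes p x x' :: nat
  assumes "prime p" "x \<noteq> 0"
  shows "p ^ min (multiplicity p x') (n * multiplicity p x) dvd gcd x' (x ^ n)"
proof -
  have "p ^ (n * multiplicity p x) dvd x ^ n"
    using dvd_power_same[OF multiplicity_dvd[of p x], of n] by (simp add: power_mult[symmetric] mult.commute)
  moreover have "p ^ multiplicity p x' dvd x'" by (rule multiplicity_dvd)
  ultimately show ?thesis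
    by (meson gcd_greatest min.cobounded1 min.cobounded2 dvd_trans le_imp_power_dvd)
qed

lemma multiplicity_abc:
  assumes "sum_pair (a, b)" "prime p"
  shows "multiplicity p (abc_product (a, b)) =
    (if place_type (a, b) p = 0 then multiplicity p a
     else if place_type (a, b) p = 1 then multiplicity p b else multiplicity p (a + b))"
proof -
  have "multiplicity p (abc_product (a, b)) = multiplicity p a + multiplicity p b + multiplicity p (a + b)"
    using assms by (simp add: abc_product_def sum_pair_def prime_elem_multiplicity_mult_distrib)
  moreover have "\<not> p dvd b" "\<not> p dvd a + b" if "p dvd a"
    using that assms coprime_common_divisor_nat[of a b p]
    by (auto simp: sum_pair_def dvd_add_right_iff)
  moreover have "\<not> p dvd a + b" if "p dvd b" "\<not> p dvd a"
    using that by (simp add: dvd_add_left_iff)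
  ultimately show ?thesis
    by (auto simp: place_type_def not_dvd_imp_multiplicity_0)
qed

text \<open>
  If the type of \<open>p\<close> is the same in both triples, its powers in
  \<open>abc_product x\<close> and \<open>abc_product x'\<close> sit in the same entry, hence in
  the same of the three gcds. The factor \<open>m\<close> enters only once, even for large
  \<open>n\<close>, because \<open>x'\<close> contains it only once.
\<close>
lemma dvd_gcd_product:
  assumes S: "finite S" "\<And>p. p \<in> S \<Longrightarrow> prime p"
    and x: "sum_pair x" and x': "sum_pair x'"
    and type: "\<And>p. p \<in> S \<Longrightarrow> place_type x p = place_type x' p"
    and m: "\<And>p. p \<in> S \<Longrightarrow> coprime m p"
    and mx: "m dvd fst x \<and> m dvd fst x' \<or> m dvd snd x \<and> m dvd snd x' \<or>
             m dvd fst x + snd x \<and> m dvd fst x' + snd x'"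
    and "n \<ge> 1"
  shows "m * (\<Prod>p\<in>S. p ^ min (multiplicity p (abc_product x')) (n * multiplicity p (abc_product x)))
         dvd gcd_product n x x'"
proof (rule divides_mult)
  obtain a b a' b' where ab: "x = (a, b)" "x' = (a', b')" by (cases x, cases x')
  have pow: "m dvd y ^ n" if "m dvd y" for y
    using dvd_trans[OF that dvd_power[of n y]] \<open>n \<ge> 1\<close> by simp
  have pow': "m dvd gcd y' (y ^ n)" if "m dvd y \<and> m dvd y'" for y y'
    using that pow by simp
  have "m dvd gcd a' (a ^ n) \<or> m dvd gcd b' (b ^ n) \<or> m dvd gcd (a' + b') ((a + b) ^ n)"
    using mx pow' unfolding ab fst_conv snd_conv by blast
  then show "m dvd gcd_product n x x'"
    unfolding ab gcd_product_def prod.case by (elim disjE) (simp_all only: dvd_mult dvd_mult2)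
  have pos: "a \<noteq> 0" "b \<noteq> 0" "a + b \<noteq> 0" using x by (auto simp: ab sum_pair_def)
  show "(\<Prod>p\<in>S. p ^ min (multiplicity p (abc_product x')) (n * multiplicity p (abc_product x)))
         dvd gcd_product n x x'"
  proof (rule prod_coprime_dvd[OF S(1)])
    fix p assume p: "p \<in> S"
    note pr = S(2)[OF p]
    have "p ^ min (multiplicity p (abc_product x')) (n * multiplicity p (abc_product x)) dvd
        (if place_type x p = 0 then gcd a' (a ^ n) else if place_type x p = 1 then gcd b' (b ^ n)
         else gcd (a' + b') ((a + b) ^ n))"
      using type[OF p] prime_power_dvd_gcd[OF pr pos(1), of a' n] prime_power_dvd_gcd[OF pr pos(2), of b' n]
        prime_power_dvd_gcd[OF pr pos(3), of "a' + b'" n]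
      unfolding ab multiplicity_abc[OF x[unfolded ab] pr] multiplicity_abc[OF x'[unfolded ab] pr]
      by (simp split: if_splits)
    also have "\<dots> dvd gcd_product n x x'"
      unfolding gcd_product_def ab prod.case by (simp only: split: if_splits) (simp add: mult.assoc)
    finally show "p ^ min (multiplicity p (abc_product x')) (n * multiplicity p (abc_product x))
         dvd gcd_product n x x'" .
  next
    fix p q assume "p \<in> S" "q \<in> S" "p \<noteq> q"
    then have "coprime p q" using S(2) primes_coprime by blast
    then show "coprime (p ^ min (multiplicity p (abc_product x')) (n * multiplicity p (abc_product x)))
        (q ^ min (multiplicity q (abc_product x')) (n * multiplicity q (abc_product x)))"
      by simp
  qed
  show "coprime m (\<Prod>p\<in>S. p ^ min (multiplicity p (abc_product x')) (n * multiplicity p (abc_product x)))"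
    using m by (intro prod_coprime_right) auto
qed

lemma log_prod:
  fixes f :: "'i \<Rightarrow> real"
  assumes "finite I" "\<And>i. i \<in> I \<Longrightarrow> f i > 0"
  shows "log b (prod f I) = (\<Sum>i\<in>I. log b (f i))"
  using assms
proof (induction I)
  case (insert i I)
  then have "log b (prod f I) = (\<Sum>i\<in>I. log b (f i))" by auto
  moreover have "prod f I > 0" "f i > 0" using insert.prems by (auto intro!: prod_pos)
  ultimately show ?case
    by (simp only: prod.insert[OF insert.hyps] sum.insert[OF insert.hyps] log_mult_pos)
qed simp

definition height :: "nat \<times> nat \<Rightarrow> real" where
  "height = (\<lambda>(a, b). log 2 (a + b))"

definition weight :: "nat \<times> nat \<Rightarrow> nat \<Rightarrow> real" where
  "weight x p = multiplicity p (abc_product x) * log 2 p"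

text \<open>
  The archimedean counterpart of \<open>weight\<close>: minus the logarithm of the smallest entry,
  after scaling the largest one to \<open>1\<close>.
\<close>
definition weight_inf :: "nat \<times> nat \<Rightarrow> real" where
  "weight_inf = (\<lambda>(a, b). log 2 ((a + b) / a))"

definition rounding :: "real \<Rightarrow> real \<Rightarrow> real \<Rightarrow> nat" where
  "rounding \<kappa> h w = nat \<lfloor>w * \<kappa> / h\<rfloor>"

text \<open>
  The common rounded value \<open>r\<close> of \<open>w \<kappa> / h\<close> and
  \<open>w' \<kappa> / h'\<close> bounds \<open>w'\<close> below by
  \<open>r h' / \<kappa>\<close>, hence by \<open>n r h / \<kappa>\<close>, and
  \<open>r h / \<kappa>\<close> falls short of \<open>w\<close> by at most
  \<open>h / \<kappa>\<close>.
\<close>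
lemma rounding_eq_imp_min_ge:
  assumes "rounding \<kappa> h w = rounding \<kappa> h' w'" "\<kappa> > 0" "h > 0" "n * h \<le> h'" "n \<ge> 1" "w \<ge> 0" "w' \<ge> 0"
  shows "n * (w - h / \<kappa>) \<le> min w' (n * w)"
proof -
  define r where "r = real (rounding \<kappa> h w)"
  have h': "h' > 0" using assms by (smt (verit) mult_le_cancel_right1)
  have "r \<le> w' * \<kappa> / h'" unfolding r_def assms(1) using assms h' by (simp add: rounding_def)
  then have 1: "r * h' \<le> w' * \<kappa>" using h' by (simp add: field_simps)
  have "w * \<kappa> / h < r + 1" unfolding r_def using assms by (simp add: rounding_def) linarith
  then have 2: "w * \<kappa> \<le> r * h + h" using \<open>h > 0\<close> by (simp add: field_simps)
  have r: "r \<ge> 0" by (simp add: r_def)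
  have "n * (w * \<kappa> - h) \<le> n * (r * h)" using 2 \<open>n \<ge> 1\<close> by (intro mult_left_mono) auto
  also have "\<dots> = r * (n * h)" by simp
  also have "\<dots> \<le> r * h'" using r assms by (intro mult_left_mono) auto
  also note 1
  finally have "n * (w * \<kappa> - h) / \<kappa> \<le> w'" using \<open>\<kappa> > 0\<close> by (simp add: field_simps)
  also have "n * (w * \<kappa> - h) / \<kappa> = n * (w - h / \<kappa>)" using \<open>\<kappa> > 0\<close> by (simp add: field_simps)
  finally have "n * (w - h / \<kappa>) \<le> w'" .
  moreover have "n * (w - h / \<kappa>) \<le> n * w" using assms by (intro mult_left_mono) auto
  ultimately show ?thesis by simp
qed

text \<open>
  Product formula: the finite weights add up to \<open>log (a b c)\<close>, and
  \<open>weight_inf\<close> replaces \<open>a\<close> by \<open>c\<close>. What remains is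
  \<open>log (b c^2)\<close>, with \<open>c / 2 \<le> b \<le> c\<close>.
\<close>
lemma total_weight:
  assumes S: "finite S" "\<And>p. p \<in> S \<Longrightarrow> prime p" and x: "sum_pair x" and "m > 0"
    and fac: "abc_product x = m * (\<Prod>p\<in>S. p ^ multiplicity p (abc_product x))"
  shows "log 2 m + (\<Sum>p\<in>S. weight x p) + weight_inf x \<le> 3 * height x"
    and "log 2 m + (\<Sum>p\<in>S. weight x p) + weight_inf x \<ge> 3 * height x - 1"
proof -
  obtain a b where ab: "x = (a, b)" by (cases x)
  have pos: "a > 0" "b > 0" "a \<le> b" using x by (auto simp: ab sum_pair_def)
  have "log 2 (abc_product x) = log 2 m + (\<Sum>p\<in>S. weight x p)"
  proof -
    have pp: "real p > 0" if "p \<in> S" for p using S(2)[OF that] prime_gt_0_nat by auto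
    have "log 2 (real (\<Prod>p\<in>S. p ^ multiplicity p (abc_product x))) = (\<Sum>p\<in>S. weight x p)"
      using pp S(1) unfolding weight_def of_nat_prod
      by (subst log_prod) (auto simp: log_nat_power intro!: sum.cong)
    moreover have "(\<Prod>p\<in>S. p ^ multiplicity p (abc_product x)) > 0" using pp by (auto intro!: prod_pos)
    moreover have "log 2 (abc_product x) = log 2 (real m * real (\<Prod>p\<in>S. p ^ multiplicity p (abc_product x)))"
      by (subst fac) simp
    ultimately show ?thesis
      using \<open>m > 0\<close> by (simp add: log_mult_pos del: of_nat_prod)
  qed
  moreover have "log 2 (abc_product x) + weight_inf x = log 2 b + 2 * height x"
    using pos by (simp add: ab abc_product_def weight_inf_def height_def log_mult log_divide)
  moreover have "log 2 b \<le> height x" using pos by (simp add: ab height_def)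
  moreover have "log 2 (a + b) \<le> log 2 (2 * b)" using pos by simp
  then have "height x - 1 \<le> log 2 b" using pos by (simp add: ab height_def log_mult)
  ultimately show "log 2 m + (\<Sum>p\<in>S. weight x p) + weight_inf x \<le> 3 * height x"
    "log 2 m + (\<Sum>p\<in>S. weight x p) + weight_inf x \<ge> 3 * height x - 1" by linarith+
qed

text \<open>
  Two triples have the same profile if they point in nearly the same direction in the space of
  logarithmic valuations: after division by the height, their weights agree up to
  \<open>1 / \<kappa>\<close>, place by place, and the primes of \<open>S\<close> that occur in
  both sit in the same entries.
\<close>
definition same_profile :: "nat set \<Rightarrow> nat \<Rightarrow> real \<Rightarrow> nat \<times> nat \<Rightarrow> nat \<times> nat \<Rightarrow> bool" where
  "same_profile S m \<kappa> x x' \<longleftrightarrow>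
     (\<forall>p\<in>S. place_type x p = place_type x' p) \<and>
     (\<forall>p\<in>S. rounding \<kappa> (height x) (weight x p) = rounding \<kappa> (height x') (weight x' p)) \<and>
     rounding \<kappa> (height x) (weight_inf x) = rounding \<kappa> (height x') (weight_inf x') \<and>
     rounding \<kappa> (height x) (log 2 m) = rounding \<kappa> (height x') (log 2 m)"

lemma weight_inf_nonneg: "sum_pair x \<Longrightarrow> weight_inf x \<ge> 0"
  by (cases x) (auto simp: sum_pair_def weight_inf_def intro!: zero_le_log_cancel_iff[THEN iffD2])

text \<open>
  The choice of \<open>\<kappa>\<close> makes the rounding errors at the \<open>|S| + 2\<close>
  places (those of \<open>S\<close>, the archimedean one, and the factor \<open>m\<close> regarded
  as one place) amount to \<open>height x / 12\<close> in total.
\<close>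
lemma log_gcd_product_ge:
  fixes \<kappa> :: real
  assumes S: "finite S" "\<And>p. p \<in> S \<Longrightarrow> prime p"
    and x: "sum_pair x" and x': "sum_pair x'"
    and fac: "abc_product x = m * (\<Prod>p\<in>S. p ^ multiplicity p (abc_product x))"
    and prof: "same_profile S m \<kappa> x x'"
    and m: "m > 0" "\<And>p. p \<in> S \<Longrightarrow> coprime m p"
    and mx: "m dvd fst x \<and> m dvd fst x' \<or> m dvd snd x \<and> m dvd snd x' \<or>
             m dvd fst x + snd x \<and> m dvd fst x' + snd x'"
    and n: "n \<ge> 1" and h: "height x > 0" "n * height x \<le> height x'"
    and \<kappa>: "\<kappa> = 12 * (card S + 2)"
  shows "n * ((3 - 1/12) * height x - 1) \<le>
           log 2 (gcd_product n x x') + min (weight_inf x') (n * weight_inf x)"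
proof -
  let ?d = "height x / \<kappa>"
  have kp: "\<kappa> > 0" using \<kappa> by simp
  have r: "n * (w - ?d) \<le> min w' (n * w)"
    if "rounding \<kappa> (height x) w = rounding \<kappa> (height x') w'" "w \<ge> 0" "w' \<ge> 0" for w w' :: real
    using rounding_eq_imp_min_ge[OF that(1) kp h(1,2) _ that(2,3)] n h by simp
  have pp: "real p > 1" if "p \<in> S" for p using S(2)[OF that] prime_gt_1_nat by auto
  let ?e = "\<lambda>p. min (multiplicity p (abc_product x')) (n * multiplicity p (abc_product x))"
  have wp: "n * (weight x p - ?d) \<le> ?e p * log 2 p" if "p \<in> S" for p
  proof -
    have lp: "log 2 p > 0" using pp[OF that] by simp
    have "n * (weight x p - ?d) \<le> min (weight x' p) (n * weight x p)"
      using prof that lp unfolding weight_def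
      by (intro r) (auto simp: same_profile_def weight_def)
    also have "\<dots> = ?e p * log 2 p"
      using lp unfolding weight_def of_nat_min
      by (simp add: min_def)
    finally show ?thesis .
  qed
  have wm: "n * (log 2 m - ?d) \<le> log 2 m"
  proof -
    have "n * (log 2 m - ?d) \<le> min (log 2 m) (n * log 2 m)"
      using prof m by (intro r) (auto simp: same_profile_def)
    then show ?thesis by simp
  qed
  have wi: "n * (weight_inf x - ?d) \<le> min (weight_inf x') (n * weight_inf x)"
    using prof weight_inf_nonneg x x' by (intro r) (auto simp: same_profile_def)
  have gpos: "gcd_product n x x' > 0"
    using x x' by (cases x, cases x') (auto simp: gcd_product_def sum_pair_def)
  from dvd_gcd_product[OF S x x' _ m(2) mx n] prof gpos
  have "m * (\<Prod>p\<in>S. p ^ ?e p) \<le> gcd_product n x x'"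
    by (intro dvd_imp_le) (auto simp: same_profile_def)
  then have "real m * (\<Prod>p\<in>S. real p ^ ?e p) \<le> gcd_product n x x'"
    unfolding of_nat_mult[symmetric] of_nat_prod[symmetric] of_nat_power[symmetric] by (rule of_nat_mono)
  moreover have P: "(\<Prod>p\<in>S. real p ^ ?e p) > 0" using pp by (intro prod_pos) (force intro: zero_less_power)
  ultimately have "log 2 (m * (\<Prod>p\<in>S. real p ^ ?e p)) \<le> log 2 (gcd_product n x x')"
    using m gpos by (subst log_le_cancel_iff) auto
  also have "log 2 (m * (\<Prod>p\<in>S. real p ^ ?e p)) = log 2 m + log 2 (\<Prod>p\<in>S. real p ^ ?e p)"
    using P m by (subst log_mult) auto
  also have "log 2 (\<Prod>p\<in>S. real p ^ ?e p) = (\<Sum>p\<in>S. ?e p * log 2 p)"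
    using pp S(1) by (subst log_prod) (force simp: log_nat_power intro!: sum.cong)+
  finally have G: "log 2 m + (\<Sum>p\<in>S. ?e p * log 2 p) \<le> log 2 (gcd_product n x x')" .
  have "(\<Sum>p\<in>S. n * (weight x p - ?d)) \<le> (\<Sum>p\<in>S. ?e p * log 2 p)"
    by (intro sum_mono wp)
  moreover have "(\<Sum>p\<in>S. n * (weight x p - ?d)) = n * ((\<Sum>p\<in>S. weight x p) - card S * ?d)"
    by (simp add: sum_distrib_left[symmetric] sum_subtractf)
  ultimately have ws: "n * ((\<Sum>p\<in>S. weight x p) - card S * ?d) \<le> (\<Sum>p\<in>S. ?e p * log 2 p)"
    by simp
  have "n * ((\<Sum>p\<in>S. weight x p) - card S * ?d) + n * (log 2 m - ?d) + n * (weight_inf x - ?d)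
     \<le> log 2 (gcd_product n x x') + min (weight_inf x') (n * weight_inf x)"
    by (rule order_trans[OF add_mono[OF add_mono[OF ws wm] wi]]) (use G in simp)
  also have "n * ((\<Sum>p\<in>S. weight x p) - card S * ?d) + n * (log 2 m - ?d) + n * (weight_inf x - ?d) =
     n * (log 2 m + (\<Sum>p\<in>S. weight x p) + weight_inf x - (card S + 2) * ?d)"
    by (simp add: algebra_simps)
  also have "(card S + 2) * ?d = height x / 12" using \<kappa> by (simp add: field_simps)
  finally have "n * (log 2 m + (\<Sum>p\<in>S. weight x p) + weight_inf x - height x / 12)
     \<le> log 2 (gcd_product n x x') + min (weight_inf x') (n * weight_inf x)" .
  moreover have "n * ((3 - 1/12) * height x - 1) \<le> n * (log 2 m + (\<Sum>p\<in>S. weight x p) + weight_inf x - height x / 12)"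
    using total_weight(2)[OF S x m(1) fac] by (intro mult_left_mono) auto
  ultimately show ?thesis by linarith
qed

section \<open>At most eight triples of large height share a profile\<close>

lemma gcd_product_pos: "sum_pair x \<Longrightarrow> sum_pair x' \<Longrightarrow> gcd_product n x x' > 0"
  by (cases x, cases x') (auto simp: gcd_product_def sum_pair_def)

lemma log_gcd_product_le_distinct:
  assumes "sum_pair x" "sum_pair x'" "x \<noteq> x'"
  shows "log 2 (gcd_product 1 x x') \<le> height x + height x' - min (weight_inf x') (weight_inf x)"
proof -
  obtain a b a' b' where ab: "x = (a, b)" "x' = (a', b')" by (cases x, cases x')
  have pos: "a > 0" "b > 0" "a' > 0" "b' > 0" using assms by (auto simp: ab sum_pair_def)
  have "real (gcd_product 1 x x') \<le> max (a' * (a + b)) ((a' + b') * a)"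
    using gcd_product_le_distinct_nat[of a b a' b'] assms unfolding ab by (intro of_nat_mono) auto
  then have "log 2 (gcd_product 1 x x') \<le> log 2 (max (a' * (a + b)) ((a' + b') * a))"
    using gcd_product_pos[OF assms(1,2), of 1] by (intro log_mono) auto
  also have "\<dots> = max (log 2 (real a' * real (a + b))) (log 2 (real (a' + b') * real a))"
    using pos by (simp add: max_def del: of_nat_add flip: of_nat_mult)
  also have "\<dots> = height x + height x' - min (weight_inf x') (weight_inf x)"
    using pos by (simp add: ab height_def weight_inf_def log_mult_pos log_divide_pos add_pos_pos max_def min_def)
  finally show ?thesis .
qed

lemma log_gcd_product_le:
  assumes "sum_pair x" "sum_pair x'" "odd M"
  shows "log 2 (gcd_product (2 * M + 1) x x') \<le> 4 * M + 1 + (3 * M + 1) * height x + height x'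
           - min (weight_inf x') ((2 * M + 1) * weight_inf x)"
proof -
  obtain a b a' b' where ab: "x = (a, b)" "x' = (a', b')" by (cases x, cases x')
  have pos: "a > 0" "b > 0" "a' > 0" "b' > 0" using assms by (auto simp: ab sum_pair_def)
  let ?n = "2 * M + 1" and ?c = "real (a + b)" and ?c' = "real (a' + b')"
  let ?mx = "max (real a' * ?c ^ ?n) (?c' * real a ^ ?n)"
  have c: "?c > 0" "?c' > 0" using pos by auto
  have mxpos: "?mx > 0" using pos c by (auto simp: less_max_iff_disj)
  have "M + 1 \<le> 2 ^ M" using less_exp[of M] by linarith
  then have M: "real (M + 1) \<le> 2 ^ M" by (metis of_nat_le_iff of_nat_numeral of_nat_power)
  have "real (gcd_product ?n x x') \<le>
      real ((M + 1) * 8 ^ M * (a + b) ^ M * (a' * (a + b) ^ ?n + (a' + b') * a ^ ?n))"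
    using gcd_product_le_nat[of a b a' b' M] assms unfolding ab by (intro of_nat_mono) auto
  also have "\<dots> = real (M + 1) * 8 ^ M * ?c ^ M * (real a' * ?c ^ ?n + ?c' * real a ^ ?n)"
    by (simp only: of_nat_mult of_nat_power of_nat_add of_nat_numeral)
  also have "\<dots> \<le> 2 ^ M * 8 ^ M * ?c ^ M * (2 * ?mx)"
    using M c pos by (intro mult_mono) auto
  also have "\<dots> = 2 ^ (4 * M + 1) * ?c ^ M * ?mx"
    by (simp add: power_mult_distrib[symmetric] power_mult)
  finally have "log 2 (gcd_product ?n x x') \<le> log 2 (2 ^ (4 * M + 1) * ?c ^ M * ?mx)"
    using gcd_product_pos[OF assms(1,2), of ?n] by (intro log_mono) auto
  also have "\<dots> = log 2 (2 ^ (4 * M + 1)) + log 2 (?c ^ M) + log 2 ?mx"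
    using c mxpos by (simp only: log_mult_pos mult_pos_pos zero_less_power zero_less_numeral)
  also have "log 2 (2 ^ (4 * M + 1) :: real) = 4 * M + 1" by (subst log_nat_power) auto
  also have "log 2 (?c ^ M) = M * height x"
    using c by (subst log_nat_power) (auto simp: ab height_def)
  also have "log 2 ?mx = max (log 2 (real a' * ?c ^ ?n)) (log 2 (?c' * real a ^ ?n))"
  proof -
    have "real a' * ?c ^ ?n > 0" "?c' * real a ^ ?n > 0" using pos c by (simp_all del: power_Suc of_nat_add)
    then show ?thesis unfolding max_def by simp
  qed
  also have "log 2 (real a' * ?c ^ ?n) = height x' - weight_inf x' + ?n * height x"
    using pos c by (simp add: log_mult_pos log_nat_power log_divide_pos ab height_def weight_inf_def
        del: power_Suc)
  also have "log 2 (?c' * real a ^ ?n) = height x' + ?n * (height x - weight_inf x)"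
    using pos c by (simp add: log_mult_pos log_nat_power log_divide_pos ab height_def weight_inf_def
        del: power_Suc)
  finally show ?thesis by (simp add: max_def min_def algebra_simps split: if_splits)
qed

definition entry :: "nat \<Rightarrow> nat \<times> nat \<Rightarrow> nat" where
  "entry i = (\<lambda>(a, b). if i = 0 then a else if i = 1 then b else a + b)"

text \<open>
  The index \<open>i\<close> names the entry that carries the factor \<open>m\<close>, so that two
  members have \<open>m\<close> in the same entry.
\<close>
definition S_triples :: "nat set \<Rightarrow> nat \<Rightarrow> nat \<Rightarrow> (nat \<times> nat) set" where
  "S_triples S m i = {x. sum_pair x \<and> m dvd entry i x \<and>
     abc_product x = m * (\<Prod>p\<in>S. p ^ multiplicity p (abc_product x))}"

text \<open>
  On the scale of logarithms to base \<open>3/2\<close>, distinct values are at least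
  \<open>1\<close> apart and all lie in an interval of length less than \<open>8\<close>, as
  \<open>19 < (3/2)^8\<close>.
\<close>
lemma card_le_8_if_growth:
  fixes f :: "'a \<Rightarrow> real"
  assumes "finite X" and pos: "\<And>x. x \<in> X \<Longrightarrow> f x > 0"
    and gap: "\<And>x y. x \<in> X \<Longrightarrow> y \<in> X \<Longrightarrow> x \<noteq> y \<Longrightarrow> f x \<le> f y \<Longrightarrow> 3/2 * f x \<le> f y"
    and bound: "\<And>x y. x \<in> X \<Longrightarrow> y \<in> X \<Longrightarrow> f y < 19 * f x"
  shows "card X \<le> 8"
proof (cases "X = {}")
  case False
  define f0 where "f0 = Min (f ` X)"
  have "f0 \<in> f ` X" unfolding f0_def using False \<open>finite X\<close> by (intro Min_in) auto
  then obtain x0 where x0: "x0 \<in> X" "f x0 = f0" by auto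
  have f0: "f0 > 0" "\<And>x. x \<in> X \<Longrightarrow> f0 \<le> f x"
    using x0 pos[OF x0(1)] \<open>finite X\<close> by (simp, simp add: f0_def)
  define g where "g x = log (3/2) (f x / f0)" for x
  have g: "0 \<le> g x" "g x < 8" if "x \<in> X" for x
  proof -
    have r: "1 \<le> f x / f0" "f x / f0 < 19"
      using f0(1) f0(2)[OF that] bound[OF x0(1) that] x0 by (auto simp: field_simps)
    then show "0 \<le> g x" unfolding g_def by simp
    have "(19::real) < (3/2) ^ 8" by (simp add: power_divide)
    then have "f x / f0 < (3/2) ^ 8" using r by linarith
    then show "g x < 8" unfolding g_def using r by (simp add: log_less_iff powr_numeral)
  qed
  have "inj_on (\<lambda>x. nat \<lfloor>g x\<rfloor>) X"
  proof (rule inj_onI, rule ccontr)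
    have *: False if "x \<in> X" "y \<in> X" "x \<noteq> y" "f x \<le> f y" "nat \<lfloor>g x\<rfloor> = nat \<lfloor>g y\<rfloor>" for x y
    proof -
      have "3/2 * f x / f0 \<le> f y / f0"
        using gap[OF that(1-4)] f0(1) by (intro divide_right_mono) auto
      then have "log (3/2) (3/2 * f x / f0) \<le> g y"
        unfolding g_def using pos[OF that(1)] f0(1) by (intro log_mono) auto
      also have "log (3/2) (3/2 * f x / f0) = 1 + g x"
        unfolding g_def using pos[OF that(1)] f0(1) log_mult_pos[of "3/2" "f x / f0" "3/2"] by simp
      finally have "1 + g x \<le> g y" .
      moreover have "\<lfloor>g x\<rfloor> = \<lfloor>g y\<rfloor>" using that g by (simp add: eq_nat_nat_iff)
      ultimately show False by linarith
    qed
    fix x y assume "x \<in> X" "y \<in> X" "nat \<lfloor>g x\<rfloor> = nat \<lfloor>g y\<rfloor>" "x \<noteq> y"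
    then show False using *[of x y] *[of y x] by (cases "f x \<le> f y") auto
  qed
  moreover have "(\<lambda>x. nat \<lfloor>g x\<rfloor>) ` X \<subseteq> {..<8}"
    using g by (auto simp: floor_less_iff nat_less_iff)
  ultimately have "card X \<le> card {..<8::nat}" by (intro card_inj_on_le) auto
  then show ?thesis by simp
qed simp

context
  fixes S :: "nat set" and m i :: nat and \<kappa> :: real
  assumes S: "finite S" "\<And>p. p \<in> S \<Longrightarrow> prime p"
    and m: "m > 0" "\<And>p. p \<in> S \<Longrightarrow> coprime m p"
    and \<kappa>: "\<kappa> = 12 * (card S + 2)"
begin

text \<open>
  With \<open>h\<close> and \<open>h'\<close> for the heights, the two bounds for
  \<open>gcd_product 1\<close> give \<open>(3 - 1/12) h - 1 \<le> h + h'\<close>.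
\<close>
lemma height_gap:
  assumes "x \<in> S_triples S m i" "x' \<in> S_triples S m i" "same_profile S m \<kappa> x x'" "x \<noteq> x'"
    and "14 \<le> height x" "height x \<le> height x'"
  shows "3/2 * height x \<le> height x'"
proof -
  have sp: "sum_pair x" "sum_pair x'" using assms by (auto simp: S_triples_def)
  have "real 1 * ((3 - 1/12) * height x - 1) \<le>
           log 2 (gcd_product 1 x x') + min (weight_inf x') (real 1 * weight_inf x)"
    using assms by (intro log_gcd_product_ge[OF S sp _ _ m _ _ _ _ \<kappa>])
      (auto simp: S_triples_def entry_def split: if_splits prod.splits)
  then show ?thesis using log_gcd_product_le_distinct[OF sp assms(4)] assms(5) by simp
qed

text \<open>
  Otherwise the ratio of the heights lies in \<open>[2 M + 1, 2 M + 5)\<close> for some odd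
  \<open>M \<ge> 9\<close>; such intervals cover \<open>[19, \<infinity>)\<close>. The bounds
  for \<open>gcd_product (2 M + 1)\<close> then force
  \<open>(10 M - 37) h \<le> 12 (6 M + 2)\<close>, which fails for
  \<open>M \<ge> 9\<close> and \<open>h \<ge> 14\<close>.
\<close>
lemma height_bound:
  assumes "x \<in> S_triples S m i" "x' \<in> S_triples S m i" "same_profile S m \<kappa> x x'"
    and h: "14 \<le> height x"
  shows "height x' < 19 * height x"
proof (rule ccontr)
  assume neg: "\<not> height x' < 19 * height x"
  have sp: "sum_pair x" "sum_pair x'" using assms by (auto simp: S_triples_def)
  define j where "j = nat \<lfloor>(height x' / height x - 19) / 4\<rfloor>"
  define M where "M = 9 + 2 * j"
  have "0 \<le> (height x' / height x - 19) / 4" using neg h by (simp add: field_simps)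
  then have "real j \<le> (height x' / height x - 19) / 4" "(height x' / height x - 19) / 4 < real j + 1"
    unfolding j_def by linarith+
  then have "real (2 * M + 1) \<le> height x' / height x" "height x' / height x < real (2 * M + 5)"
    unfolding M_def by (simp_all add: field_simps)
  then have n: "real (2 * M + 1) * height x \<le> height x'" "height x' < real (2 * M + 5) * height x"
    using h by (simp_all add: field_simps)
  have "real (2 * M + 1) * ((3 - 1/12) * height x - 1) \<le>
           log 2 (gcd_product (2 * M + 1) x x') + min (weight_inf x') (real (2 * M + 1) * weight_inf x)"
    using assms n by (intro log_gcd_product_ge[OF S sp _ _ m _ _ _ _ \<kappa>])
      (auto simp: S_triples_def entry_def split: if_splits prod.splits)
  also have "\<dots> \<le> 4 * M + 1 + (3 * M + 1) * height x + height x'"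
    using log_gcd_product_le[OF sp, of M] by (simp add: M_def)
  also have "\<dots> \<le> 4 * M + 1 + (3 * M + 1) * height x + (2 * M + 5) * height x"
    using n(2) by simp
  finally have "(10 * real M - 37) * height x \<le> 12 * (6 * real M + 2)"
    by (simp add: algebra_simps)
  moreover have "(10 * real M - 37) * 14 \<le> (10 * real M - 37) * height x"
    using h by (intro mult_left_mono) (auto simp: M_def)
  ultimately show False by (simp add: M_def)
qed

lemma card_same_profile_le:
  assumes "finite X" "X \<subseteq> S_triples S m i" "\<And>x. x \<in> X \<Longrightarrow> 14 \<le> height x"
    and "\<And>x y. x \<in> X \<Longrightarrow> y \<in> X \<Longrightarrow> same_profile S m \<kappa> x y"
  shows "card X \<le> 8"
proof (rule card_le_8_if_growth[OF assms(1), of height])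
  fix x y assume xy: "x \<in> X" "y \<in> X"
  show "height x > 0" using assms(3)[OF xy(1)] by simp
  show "height y < 19 * height x" using xy assms by (intro height_bound) auto
  show "3/2 * height x \<le> height y" if "x \<noteq> y" "height x \<le> height y"
    using xy assms that by (intro height_gap) auto
qed

end

section \<open>Counting profiles\<close>

lemma sum_power_37_36: "(\<Sum>j\<le>K. (37/36) ^ (K - j)) \<le> 37 * (37/36 :: real) ^ K"
proof -
  have "(\<Sum>j\<le>K. (37/36) ^ (K - j)) = (\<Sum>j\<le>K. (37/36 :: real) ^ j)"
    by (rule sum.reindex_bij_witness[of _ "\<lambda>j. K - j" "\<lambda>j. K - j"]) auto
  also have "\<dots> = 36 * ((37/36) ^ Suc K - 1)"
    by (subst sum_gp0) (simp add: field_simps)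
  finally show ?thesis by simp
qed

text \<open>
  A generating function bound: the number of vectors with coordinate sum at most \<open>K\<close>
  is at most \<open>z^(-K) (1 - z)^(- |I|)\<close> for every \<open>0 < z < 1\<close>. The
  value \<open>z = 36/37\<close> is close to optimal when \<open>K = 36 |I|\<close>, the only
  case of interest.
\<close>
lemma card_bounded_sum:
  fixes K :: nat
  assumes "finite I"
  shows "finite {q \<in> I \<rightarrow>\<^sub>E UNIV. sum q I \<le> K} \<and>
         real (card {q \<in> I \<rightarrow>\<^sub>E UNIV. sum q I \<le> K}) \<le> (37/36) ^ K * 37 ^ card I"
  using assms
proof (induction I arbitrary: K)
  case empty
  have "{q \<in> {} \<rightarrow>\<^sub>E UNIV. sum q {} \<le> K} = {\<lambda>_. undefined}" by auto
  then show ?case by simp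
next
  case (insert i I)
  let ?B = "\<lambda>J K. {q \<in> J \<rightarrow>\<^sub>E (UNIV :: nat set). sum q J \<le> K}"
  have fin: "finite (?B I K)" and le: "real (card (?B I K)) \<le> (37/36) ^ K * 37 ^ card I" for K
    using insert.IH[of K] by auto
  have sub: "?B (insert i I) K \<subseteq> (\<Union>j\<in>{..K}. (\<lambda>q. q(i := j)) ` ?B I (K - j))"
  proof
    fix q assume q: "q \<in> ?B (insert i I) K"
    then have s: "q i + sum q I \<le> K" using insert.hyps by simp
    have e: "sum (q(i := undefined)) I = sum q I"
      using insert.hyps by (intro sum.cong) auto
    have qm: "q(i := undefined) \<in> ?B I (K - q i)"
      using q s insert.hyps unfolding mem_Collect_eq e by (auto simp: PiE_iff extensional_def)
    have "q i \<in> {..K}" using s by simp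
    moreover have "q \<in> (\<lambda>r. r(i := q i)) ` ?B I (K - q i)"
      by (rule image_eqI[OF _ qm]) simp
    ultimately show "q \<in> (\<Union>j\<in>{..K}. (\<lambda>q. q(i := j)) ` ?B I (K - j))"
      by (rule UN_I)
  qed
  have finU: "finite (\<Union>j\<in>{..K}. (\<lambda>q. q(i := j)) ` ?B I (K - j))"
    using fin by auto
  have "card (?B (insert i I) K) \<le> card (\<Union>j\<in>{..K}. (\<lambda>q. q(i := j)) ` ?B I (K - j))"
    by (rule card_mono[OF finU sub])
  also have "\<dots> \<le> (\<Sum>j\<le>K. card ((\<lambda>q. q(i := j)) ` ?B I (K - j)))"
    by (rule card_UN_le) simp
  also have "\<dots> \<le> (\<Sum>j\<le>K. card (?B I (K - j)))"
    using fin by (intro sum_mono card_image_le)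
  finally have "card (?B (insert i I) K) \<le> (\<Sum>j\<le>K. card (?B I (K - j)))" .
  then have "real (card (?B (insert i I) K)) \<le> (\<Sum>j\<le>K. real (card (?B I (K - j))))"
    unfolding of_nat_sum[symmetric] by (rule of_nat_mono)
  also have "\<dots> \<le> (\<Sum>j\<le>K. (37/36) ^ (K - j) * 37 ^ card I)"
    by (intro sum_mono le)
  also have "\<dots> = (\<Sum>j\<le>K. (37/36) ^ (K - j)) * 37 ^ card I"
    by (rule sum_distrib_right[symmetric])
  also have "\<dots> \<le> 37 * (37/36) ^ K * 37 ^ card I"
    by (intro mult_right_mono sum_power_37_36) simp
  finally show ?case using finite_subset[OF sub finU] insert.hyps by simp
qed

text \<open>
  The indices \<open>0\<close> and \<open>1\<close>, which are not prime, are used for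
  \<open>m\<close> and for the archimedean place.
\<close>
definition rounded_profile :: "nat set \<Rightarrow> nat \<Rightarrow> real \<Rightarrow> nat \<times> nat \<Rightarrow> nat \<Rightarrow> nat" where
  "rounded_profile S m \<kappa> x = (\<lambda>p\<in>insert 0 (insert 1 S). rounding \<kappa> (height x)
     (if p = 0 then log 2 m else if p = 1 then weight_inf x else weight x p))"

lemma rounding_le: "\<kappa> \<ge> 0 \<Longrightarrow> h > 0 \<Longrightarrow> w \<ge> 0 \<Longrightarrow> rounding \<kappa> h w \<le> w * \<kappa> / h"
  by (simp add: rounding_def)

context
  fixes S :: "nat set" and m i :: nat and \<kappa> :: real
  assumes S: "finite S" "\<And>p. p \<in> S \<Longrightarrow> prime p"
    and m: "m > 0" "\<And>p. p \<in> S \<Longrightarrow> coprime m p"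
    and \<kappa>: "\<kappa> = 12 * (card S + 2)"
begin

lemma special_indices: "0 \<notin> S" "1 \<notin> S" "Suc 0 \<notin> S"
  using S(2) not_prime_0 not_prime_1 by (metis One_nat_def)+

lemma rounded_profile_sum_le:
  assumes x: "x \<in> S_triples S m i" and h: "height x > 0"
  shows "sum (rounded_profile S m \<kappa> x) (insert 0 (insert 1 S)) \<le> 36 * (card S + 2)"
proof -
  have sp: "sum_pair x" and fac: "abc_product x = m * (\<Prod>p\<in>S. p ^ multiplicity p (abc_product x))"
    using x by (auto simp: S_triples_def)
  let ?h = "height x"
  have k: "\<kappa> \<ge> 0" using \<kappa> by simp
  have wn: "weight x p \<ge> 0" if "p \<in> S" for p
    using prime_gt_1_nat[OF S(2)[OF that]] by (simp add: weight_def)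
  have "sum (rounded_profile S m \<kappa> x) (insert 0 (insert 1 S)) =
     rounding \<kappa> ?h (log 2 m) + (rounding \<kappa> ?h (weight_inf x) + (\<Sum>p\<in>S. rounding \<kappa> ?h (weight x p)))"
    using S(1) special_indices by (auto simp: rounded_profile_def intro!: sum.cong)
  then have "real (sum (rounded_profile S m \<kappa> x) (insert 0 (insert 1 S))) =
     real (rounding \<kappa> ?h (log 2 m)) + (real (rounding \<kappa> ?h (weight_inf x)) + (\<Sum>p\<in>S. real (rounding \<kappa> ?h (weight x p))))"
    by simp
  also have "\<dots> \<le> log 2 m * \<kappa> / ?h + (weight_inf x * \<kappa> / ?h + (\<Sum>p\<in>S. weight x p * \<kappa> / ?h))"
    using m weight_inf_nonneg[OF sp] wn by (intro add_mono sum_mono rounding_le k h) auto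
  also have "\<dots> = (log 2 m + (\<Sum>p\<in>S. weight x p) + weight_inf x) * \<kappa> / ?h"
    by (simp only: sum_distrib_right[symmetric] sum_divide_distrib[symmetric])
       (simp add: add_divide_distrib algebra_simps)
  also have "\<dots> \<le> (3 * ?h) * \<kappa> / ?h"
    using total_weight(1)[OF S sp m(1) fac] h k by (intro divide_right_mono mult_right_mono) auto
  also have "\<dots> = real (36 * (card S + 2))" using h \<kappa> by simp
  finally show ?thesis by (simp only: of_nat_le_iff)
qed

lemma card_large_S_triples_le:
  assumes "finite X" "X \<subseteq> S_triples S m i" and h: "\<And>x. x \<in> X \<Longrightarrow> 14 \<le> height x"
  shows "card X \<le> 8 * (3 ^ card S * 111 ^ (card S + 2))"
proof -
  define I where "I = insert 0 (insert 1 S)"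
  define key where "key x = (restrict (place_type x) S, rounded_profile S m \<kappa> x)" for x
  have I: "finite I" "card I = card S + 2"
    using S(1) special_indices by (auto simp: I_def)
  define B where "B = {q \<in> I \<rightarrow>\<^sub>E UNIV. sum q I \<le> 36 * (card S + 2)}"
  have B: "finite B" "real (card B) \<le> (37/36) ^ (36 * (card S + 2)) * 37 ^ (card S + 2)"
    using card_bounded_sum[OF I(1), of "36 * (card S + 2)"] I by (auto simp: B_def)
  \<comment> \<open>The number 111 is 3 * 37, where 3 bounds (37/36)^36.\<close>
  have "((37/36) ^ 36 :: real) \<le> 3" by (simp add: power_divide)
  then have "((37/36) ^ 36 :: real) ^ (card S + 2) \<le> 3 ^ (card S + 2)" by (intro power_mono) auto
  then have "(37/36 :: real) ^ (36 * (card S + 2)) \<le> 3 ^ (card S + 2)" by (simp only: power_mult)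
  with B(2) have "real (card B) \<le> 3 ^ (card S + 2) * 37 ^ (card S + 2)"
    by (meson mult_right_mono order_trans zero_le_numeral zero_le_power)
  also have "\<dots> = real (111 ^ (card S + 2))" by (simp add: power_mult_distrib[symmetric])
  finally have cB: "card B \<le> 111 ^ (card S + 2)" by (simp only: of_nat_le_iff)
  have sub: "key ` X \<subseteq> (S \<rightarrow>\<^sub>E {..<3}) \<times> B"
  proof
    fix k assume "k \<in> key ` X"
    then obtain x where x: "x \<in> X" "k = key x" by auto
    have "sum (rounded_profile S m \<kappa> x) I \<le> 36 * (card S + 2)"
      unfolding I_def using x(1) assms(2) h[OF x(1)] by (intro rounded_profile_sum_le) (blast, linarith)
    then show "k \<in> (S \<rightarrow>\<^sub>E {..<3}) \<times> B"
      by (auto simp: x key_def B_def rounded_profile_def I_def place_type_def split: prod.splits)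
  qed
  have fin: "finite ((S \<rightarrow>\<^sub>E {..<3::nat}) \<times> B)" using B S by (auto intro: finite_PiE)
  have "card (key ` X) \<le> card ((S \<rightarrow>\<^sub>E {..<3::nat}) \<times> B)"
    by (rule card_mono[OF fin sub])
  also have "\<dots> = 3 ^ card S * card B" using S by (simp add: card_cartesian_product card_PiE)
  also have "\<dots> \<le> 3 ^ card S * 111 ^ (card S + 2)" using cB by simp
  finally have ck: "card (key ` X) \<le> 3 ^ card S * 111 ^ (card S + 2)" .
  have fib: "card {x \<in> X. key x = k} \<le> 8" if "k \<in> key ` X" for k
  proof (rule card_same_profile_le[OF S m \<kappa>])
    show "same_profile S m \<kappa> x y" if "x \<in> {x \<in> X. key x = k}" "y \<in> {x \<in> X. key x = k}" for x y
    proof -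
      have "key x = key y" using that by auto
      then have 1: "restrict (place_type x) S p = restrict (place_type y) S p"
        and 2: "rounded_profile S m \<kappa> x p = rounded_profile S m \<kappa> y p" for p
        by (auto simp: key_def)
      have "place_type x p = place_type y p" if "p \<in> S" for p
        using 1[of p] that by simp
      moreover have "rounding \<kappa> (height x) (weight x p) = rounding \<kappa> (height y) (weight y p)"
        if "p \<in> S" for p
      proof -
        have "p \<noteq> 0" "p \<noteq> Suc 0" using that special_indices by metis+
        then show ?thesis using 2[of p] that by (simp add: rounded_profile_def)
      qed
      moreover have "rounding \<kappa> (height x) (weight_inf x) = rounding \<kappa> (height y) (weight_inf y)"
        using 2[of 1] by (simp add: rounded_profile_def)
      moreover have "rounding \<kappa> (height x) (log 2 m) = rounding \<kappa> (height y) (log 2 m)"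
        using 2[of 0] by (simp add: rounded_profile_def)
      ultimately show ?thesis unfolding same_profile_def by blast
    qed
  qed (use assms in auto)
  have "X = (\<Union>k\<in>key ` X. {x \<in> X. key x = k})" by auto
  then have "card X \<le> (\<Sum>k\<in>key ` X. card {x \<in> X. key x = k})"
    using card_UN_le[of "key ` X" "\<lambda>k. {x \<in> X. key x = k}"] assms(1) by auto
  also have "\<dots> \<le> (\<Sum>k\<in>key ` X. 8)" by (intro sum_mono fib)
  also have "\<dots> = 8 * card (key ` X)" by simp
  also have "\<dots> \<le> 8 * (3 ^ card S * 111 ^ (card S + 2))" using ck by simp
  finally show ?thesis .
qed

end

section \<open>From S-units to coprime triples\<close>

definition S_number :: "nat set \<Rightarrow> nat \<Rightarrow> bool" where
  "S_number S n \<longleftrightarrow> n > 0 \<and> (\<forall>p. prime p \<longrightarrow> p dvd n \<longrightarrow> p \<in> S)"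

lemma S_number_mult: "S_number S x \<Longrightarrow> S_number S y \<Longrightarrow> S_number S (x * y)"
  by (auto simp: S_number_def prime_dvd_mult_iff)

text \<open>
  A prime that divides \<open>x\<close> does not divide \<open>y\<close>, so it divides
  \<open>v\<close>.
\<close>
lemma S_number_cofactor:
  assumes "S_number S u" "S_number S v" "x * u = y * v" "x > 0" "coprime x y"
  shows "S_number S x"
  unfolding S_number_def
proof (intro conjI allI impI)
  fix p assume p: "prime p" "p dvd x"
  then have "\<not> p dvd y" using assms(5) by (meson coprime_common_divisor_nat not_prime_1 coprime_common_divisor not_prime_unit)
  moreover have "p dvd y * v" using p assms(3) by (metis dvd_mult2)
  ultimately have "p dvd v" using p by (simp add: prime_dvd_mult_iff)
  then show "p \<in> S" using assms(2) p by (simp add: S_number_def)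
qed fact

lemma S_unit_fraction:
  assumes "x \<in> S_units S"
  obtains n d where "x = of_int n / of_int d" "S_number S (nat \<bar>n\<bar>)" "S_number S (nat \<bar>d\<bar>)"
proof -
  obtain y where x: "x \<in> S_integers S" and y: "y \<in> S_integers S" and xy: "x * y = 1"
    using assms by (auto simp: S_units_def)
  obtain n d n' d' where q: "quotient_of x = (n, d)" "quotient_of y = (n', d')"
    by (metis surj_pair)
  have d: "d > 0" "d' > 0" using q quotient_of_denom_pos by blast+
  have e: "x = of_int n / of_int d" "y = of_int n' / of_int d'"
    using q quotient_of_div by blast+
  have "of_int (n * n') = (of_int (d * d') :: rat)"
    using xy d unfolding e by (simp add: field_simps)
  then have nn: "n * n' = d * d'" by (simp only: of_int_eq_iff)
  have sd: "S_number S (nat \<bar>d\<bar>)" "S_number S (nat \<bar>d'\<bar>)"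
    unfolding S_number_def dvd_nat_abs_iff using x y q d by (auto simp: S_integers_def)
  have "n \<noteq> 0" using nn d by auto
  have "S_number S (nat \<bar>n\<bar>)"
    unfolding S_number_def
  proof (intro conjI allI impI)
    show "0 < nat \<bar>n\<bar>" using \<open>n \<noteq> 0\<close> by simp
    fix p assume p: "prime p" "p dvd nat \<bar>n\<bar>"
    then have "p dvd nat \<bar>d\<bar> * nat \<bar>d'\<bar>"
      by (metis nn dvd_mult2 nat_abs_mult_distrib)
    then have "S_number S (nat \<bar>d\<bar> * nat \<bar>d'\<bar>)" "p dvd nat \<bar>d\<bar> * nat \<bar>d'\<bar>" using S_number_mult[OF sd] by auto
    then show "p \<in> S" using p by (simp add: S_number_def)
  qed
  with sd e show ?thesis by (intro that)
qed

lemma S_free_part: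
  fixes n :: nat
  assumes "finite S" "\<And>p. p \<in> S \<Longrightarrow> prime p" "n > 0"
  obtains m u where "n = m * u" "S_number S u" "\<And>p. p \<in> S \<Longrightarrow> coprime m p"
proof -
  have "\<exists>m u. n = m * u \<and> S_number S u \<and> (\<forall>p\<in>S. coprime m p)"
    using assms
  proof (induction S rule: finite_induct)
    case empty
    then show ?case by (intro exI[of _ n] exI[of _ 1]) (auto simp: S_number_def)
  next
    case (insert p S)
    then obtain m u where mu: "n = m * u" "S_number S u" "\<forall>p\<in>S. coprime m p" by auto
    have p: "prime p" using insert by simp
    have "m > 0" using mu insert.prems by (auto intro: gr0I)
    then obtain m' where m': "m = p ^ multiplicity p m * m'" "\<not> p dvd m'"
      using p multiplicity_decompose'[of m p] by (metis mult.commute neq0_conv not_prime_unit)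
    have pow: "q = p" if "prime q" "q dvd p ^ k" for q k
      using that p prime_dvd_power primes_dvd_imp_eq by blast
    have "S_number (insert p S) (p ^ multiplicity p m * u)"
      using mu(2) p pow by (auto simp: S_number_def prime_gt_0_nat prime_dvd_mult_iff)
    moreover have "n = m' * (p ^ multiplicity p m * u)" using mu(1) m'(1) by (simp add: mult_ac)
    moreover have "coprime m' q" if "q \<in> insert p S" for q
    proof (cases "q = p")
      case True
      then show ?thesis using m'(2) p by (metis coprime_commute prime_imp_coprime)
    next
      case False
      then have "coprime m q" using that mu(3) by auto
      then show ?thesis using m'(1) by (metis coprime_mult_left_iff)
    qed
    ultimately show ?case by blast
  qed
  then show ?thesis using that by blast
qed

text \<open>
  Puts \<open>m * w\<close> into the form required by \<open>S_triples\<close>, where the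
  multiplicities are those of the whole product: \<open>m\<close> contributes nothing to them.
\<close>
lemma S_number_prod_multiplicity:
  assumes "S_number S w" "finite S" "\<And>p. p \<in> S \<Longrightarrow> prime p" "m > 0" "\<And>p. p \<in> S \<Longrightarrow> coprime m p"
  shows "m * w = m * (\<Prod>p\<in>S. p ^ multiplicity p (m * w))"
proof -
  have w: "w > 0" using assms by (simp add: S_number_def)
  have "w = (\<Prod>p\<in>prime_factors w. p ^ multiplicity p w)"
    using w by (simp add: prime_factorization_nat)
  also have "\<dots> = (\<Prod>p\<in>S. p ^ multiplicity p w)"
    using assms(1-3) w
    by (intro prod.mono_neutral_left) (auto simp: S_number_def prime_factors_dvd not_dvd_imp_multiplicity_0)
  also have "\<dots> = (\<Prod>p\<in>S. p ^ multiplicity p (m * w))"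
  proof (rule prod.cong[OF refl])
    fix p assume p: "p \<in> S"
    have "\<not> p dvd m" using assms(3,5)[OF p] by (metis coprime_absorb_right coprime_commute not_prime_unit)
    then have "multiplicity p (m * w) = multiplicity p w"
      using assms(3)[OF p] assms(4) w by (simp add: prime_elem_multiplicity_mult_distrib not_dvd_imp_multiplicity_0)
    then show "p ^ multiplicity p w = p ^ multiplicity p (m * w)" by simp
  qed
  finally show ?thesis by simp
qed

text \<open>
  For \<open>X > 0\<close> and \<open>X = (X - Z) + Z\<close> the six cases are the possible signs and
  orders of the three numbers. In each of them, moving negative terms to the other side gives a
  sum of positive integers, whose smaller and larger summand are returned together with the number
  of the case. The case determines the position \<open>slot\<close> of \<open>|Z|\<close> in the
  triple.
\<close>
definition sorted_sum :: "int \<times> int \<Rightarrow> nat \<times> (nat \<times> nat)" where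
  "sorted_sum = (\<lambda>(X, Z).
     if Z < 0 then (if X \<le> - Z then (0, nat X, nat (- Z)) else (1, nat (- Z), nat X))
     else if X < Z then (if X \<le> Z - X then (2, nat X, nat (Z - X)) else (3, nat (Z - X), nat X))
     else (if Z \<le> X - Z then (4, nat Z, nat (X - Z)) else (5, nat (X - Z), nat Z)))"

definition slot :: "nat \<Rightarrow> nat" where
  "slot c = (if c \<in> {1, 4} then 0 else if c \<in> {0, 5} then 1 else 2)"

definition diff_pairs :: "(int \<times> int) set" where
  "diff_pairs = {(X, Z). X > 0 \<and> Z \<noteq> 0 \<and> X \<noteq> Z \<and> coprime X Z}"

lemma inj_sorted_sum: "inj_on sorted_sum diff_pairs"
  by (rule inj_onI) (auto simp: sorted_sum_def diff_pairs_def split: if_splits)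

lemma coprime_nat_iff_int: "X \<ge> 0 \<Longrightarrow> Z \<ge> 0 \<Longrightarrow> coprime (nat X) (nat Z) \<longleftrightarrow> coprime X Z"
  by (metis coprime_int_iff nat_0_le)

lemma coprime_diff_self: "coprime a b \<Longrightarrow> coprime a (b - a)" for a b :: int
  by (metis coprime_iff_gcd_eq_1 gcd.commute gcd_diff1)

lemma sorted_sum_properties:
  assumes "v \<in> diff_pairs" "sorted_sum v = (c, x)"
  shows "c < 6" "sum_pair x" "entry (slot c) x = nat \<bar>snd v\<bar>"
    "abc_product x = nat \<bar>fst v\<bar> * nat \<bar>fst v - snd v\<bar> * nat \<bar>snd v\<bar>"
    "fst v \<le> fst x + snd x" "\<bar>snd v\<bar> \<le> fst x + snd x"
proof -
  obtain X Z where v: "v = (X, Z)" by (cases v)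
  have pos: "X > 0" "Z \<noteq> 0" "X \<noteq> Z" "coprime X Z" using assms by (auto simp: v diff_pairs_def)
  have cop: "coprime X (- Z)" "coprime (- Z) X" "coprime X (Z - X)" "coprime (Z - X) X" "coprime Z (X - Z)" "coprime (X - Z) Z"
    using pos(4) coprime_diff_self[of X Z] coprime_diff_self[of Z X] by (simp_all add: coprime_commute)
  have "c < 6 \<and> sum_pair x \<and> entry (slot c) x = nat \<bar>Z\<bar> \<and>
    abc_product x = nat \<bar>X\<bar> * nat \<bar>X - Z\<bar> * nat \<bar>Z\<bar> \<and> X \<le> fst x + snd x \<and> \<bar>Z\<bar> \<le> fst x + snd x"
    using assms(2) pos cop unfolding v sorted_sum_def
    by (auto simp: sum_pair_def coprime_nat_iff_int entry_def slot_def abc_product_def abs_if nat_add_distrib[symmetric]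
        mult_ac split: if_splits)
  then show "c < 6" "sum_pair x" "entry (slot c) x = nat \<bar>snd v\<bar>"
    "abc_product x = nat \<bar>fst v\<bar> * nat \<bar>fst v - snd v\<bar> * nat \<bar>snd v\<bar>"
    "fst v \<le> fst x + snd x" "\<bar>snd v\<bar> \<le> fst x + snd x" by (auto simp: v)
qed

lemma final_numeric_bound:
  assumes "s \<ge> 1"
  shows "2 ^ 14 * (2 ^ 15 + 1) + 6 * (8 * (3 ^ s * 111 ^ (s + 2))) \<le> (2::nat) ^ (16 * (s + 1))"
  using assms
proof (induction s rule: dec_induct)
  case (step s)
  have "2 ^ 14 * (2 ^ 15 + 1) + 6 * (8 * (3 ^ Suc s * 111 ^ (Suc s + 2))) \<le>
      (333::nat) * (2 ^ 14 * (2 ^ 15 + 1) + 6 * (8 * (3 ^ s * 111 ^ (s + 2))))"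
    by simp
  also have "\<dots> \<le> 333 * 2 ^ (16 * (s + 1))" using step.IH by (intro mult_left_mono) auto
  also have "\<dots> \<le> 2 ^ 16 * 2 ^ (16 * (s + 1))" by (intro mult_right_mono) auto
  also have "\<dots> = 2 ^ (16 * (Suc s + 1))" by (subst power_add[symmetric]) simp
  finally show ?case .
qed simp

text \<open>
  Pairs with height below \<open>14\<close> lie in a box with fewer than \<open>2^30\<close>
  points. The others are split according to the six cases of \<open>sorted_sum\<close>, in each of
  which the triple determines the pair.
\<close>
lemma card_diff_pairs_le:
  assumes S: "finite S" "S \<noteq> {}" "\<And>p. p \<in> S \<Longrightarrow> prime p"
    and m: "m > 0" "\<And>p. p \<in> S \<Longrightarrow> coprime m p"
    and V: "finite V" "V \<subseteq> diff_pairs"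
    and fac: "\<And>X Z. (X, Z) \<in> V \<Longrightarrow> S_number S (nat \<bar>X\<bar>) \<and> S_number S (nat \<bar>X - Z\<bar>) \<and>
        (\<exists>w. nat \<bar>Z\<bar> = m * w \<and> S_number S w)"
  shows "card V \<le> 2 ^ (16 * (card S + 1))"
proof -
  let ?B = "8 * (3 ^ card S * 111 ^ (card S + 2)) :: nat"
  define small where "small = {v \<in> V. height (snd (sorted_sum v)) < 14}"
  define large where "large c = {v \<in> V. 14 \<le> height (snd (sorted_sum v)) \<and> fst (sorted_sum v) = c}" for c
  have "small \<subseteq> {1..2 ^ 14} \<times> {- (2 ^ 14)..2 ^ 14}"
  proof
    fix v assume v: "v \<in> small"
    obtain c a b where cab: "sorted_sum v = (c, (a, b))" by (metis surj_pair)
    have vd: "v \<in> diff_pairs" using v V by (auto simp: small_def)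
    note props = sorted_sum_properties[OF vd cab]
    have "log 2 (real (a + b)) < 14" using v cab by (simp add: small_def height_def)
    then have "real (a + b) < 2 powr 14" using props(2) by (simp add: sum_pair_def log_less_iff)
    also have "\<dots> = real (2 ^ 14)" by simp
    finally have "a + b < 2 ^ 14" by (simp only: of_nat_less_iff)
    then have "int (a + b) < 2 ^ 14" by simp
    then show "v \<in> {1..2 ^ 14} \<times> {- (2 ^ 14)..2 ^ 14}"
      using props(5,6) vd by (cases v) (auto simp: diff_pairs_def)
  qed
  then have "card small \<le> card ({1..2 ^ 14 :: int} \<times> {- (2 ^ 14)..2 ^ 14 :: int})"
    by (intro card_mono) auto
  then have cs: "card small \<le> 2 ^ 14 * (2 ^ 15 + 1)" by (simp add: card_cartesian_product)
  have cl: "card (large c) \<le> ?B" for c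
  proof -
    have "inj_on (\<lambda>v. snd (sorted_sum v)) (large c)"
    proof (rule inj_onI)
      fix v w assume "v \<in> large c" "w \<in> large c" "snd (sorted_sum v) = snd (sorted_sum w)"
      then have "sorted_sum v = sorted_sum w" "v \<in> diff_pairs" "w \<in> diff_pairs"
        using V by (auto simp: large_def prod_eq_iff)
      then show "v = w" using inj_sorted_sum by (auto dest: inj_onD)
    qed
    then have "card (large c) = card ((\<lambda>v. snd (sorted_sum v)) ` large c)" by (simp add: card_image)
    also have "\<dots> \<le> ?B"
    proof (rule card_large_S_triples_le[OF S(1,3) m refl])
      show "(\<lambda>v. snd (sorted_sum v)) ` large c \<subseteq> S_triples S m (slot c)"
      proof (rule image_subsetI)
        fix v assume "v \<in> large c"
        then obtain X Z where XZ: "v = (X, Z)" and v: "(X, Z) \<in> large c" by (cases v) auto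
        obtain x where cx: "sorted_sum (X, Z) = (c, x)" using v by (auto simp: large_def prod_eq_iff)
        have vV: "(X, Z) \<in> V" "(X, Z) \<in> diff_pairs" using v V by (auto simp: large_def)
        note props = sorted_sum_properties[OF vV(2) cx]
        obtain w where w: "nat \<bar>Z\<bar> = m * w" "S_number S w" using fac[OF vV(1)] by blast
        have "abc_product x = m * (nat \<bar>X\<bar> * nat \<bar>X - Z\<bar> * w)"
          using props(4) w by (simp add: mult_ac)
        moreover have "S_number S (nat \<bar>X\<bar> * nat \<bar>X - Z\<bar> * w)"
          using fac[OF vV(1)] w by (intro S_number_mult) auto
        ultimately have "abc_product x = m * (\<Prod>p\<in>S. p ^ multiplicity p (abc_product x))"
          using S_number_prod_multiplicity[OF _ S(1,3) m] by metis
        moreover have "m dvd entry (slot c) x" using props(3) w by simp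
        ultimately show "snd (sorted_sum v) \<in> S_triples S m (slot c)"
          using props(2) by (simp add: S_triples_def XZ cx)
      qed
    qed (use V in \<open>auto simp: large_def\<close>)
    finally show ?thesis .
  qed
  have "V \<subseteq> small \<union> (\<Union>c<6. large c)"
  proof
    fix v assume v: "v \<in> V"
    then have "fst (sorted_sum v) < 6" using sorted_sum_properties(1)[of v] V by (metis prod.collapse subsetD)
    then show "v \<in> small \<union> (\<Union>c<6. large c)" using v by (auto simp: small_def large_def not_less)
  qed
  then have "card V \<le> card (small \<union> (\<Union>c<6. large c))"
    using V by (intro card_mono) (auto simp: small_def large_def)
  also have "\<dots> \<le> card small + card (\<Union>c<6. large c)" by (rule card_Un_le)
  also have "card (\<Union>c<6. large c) \<le> (\<Sum>c<6. card (large c))" by (rule card_UN_le) simp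
  also have "\<dots> \<le> (\<Sum>c<(6::nat). ?B)" by (intro sum_mono cl)
  also have "card small + (\<Sum>c<(6::nat). ?B) \<le> 2 ^ 14 * (2 ^ 15 + 1) + 6 * ?B" using cs by simp
  also have "\<dots> \<le> 2 ^ (16 * (card S + 1))"
    using S by (intro final_numeric_bound) (simp add: Suc_leI card_gt_0_iff)
  finally show ?thesis by simp
qed

text \<open>
  Write \<open>c / x = Z / X\<close> in lowest terms, which determines \<open>x\<close>.
  Then \<open>(X - Z) / X = (x - c) / x\<close> is an \<open>S\<close>-unit in lowest
  terms, so \<open>X\<close> and \<open>X - Z\<close> are composed of primes of
  \<open>S\<close>, whereas the part of \<open>Z\<close> prime to \<open>S\<close> is that of the
  numerator of \<open>c\<close>, for every solution \<open>x\<close>.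
\<close>
lemma card_S_unit_solutions_le:
  fixes c :: rat
  assumes S: "finite S" "S \<noteq> {}" "\<forall>p\<in>S. prime p" and c: "c \<noteq> 0"
    and X: "finite X" "\<And>x. x \<in> X \<Longrightarrow> x \<in> S_units S" "\<And>x. x \<in> X \<Longrightarrow> x - c \<in> S_units S"
  shows "card X \<le> 2 ^ (16 * (card S + 1))"
proof (cases "X = {}")
  case False
  have pr: "\<And>p. p \<in> S \<Longrightarrow> prime p" using S by blast
  \<comment> \<open>A single solution shows that c has a denominator composed of primes of S.\<close>
  obtain C D where CD: "c = of_int C / of_int D" "S_number S (nat \<bar>D\<bar>)"
  proof -
    obtain x where "x \<in> X" using False by blast
    obtain n d n' d' where "x = of_int n / of_int d" "S_number S (nat \<bar>d\<bar>)"
      "x - c = of_int n' / of_int d'" "S_number S (nat \<bar>d'\<bar>)"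
      using S_unit_fraction[OF X(2)] S_unit_fraction[OF X(3)] \<open>x \<in> X\<close> by metis
    moreover from this have "d \<noteq> 0" "d' \<noteq> 0" by (auto simp: S_number_def)
    moreover from calculation have "c = of_int n / of_int d - of_int n' / of_int d'"
      by (simp add: algebra_simps)
    ultimately have "c = of_int (n * d' - n' * d) / of_int (d * d')" "S_number S (nat \<bar>d * d'\<bar>)"
      by (simp_all add: diff_frac_eq nat_abs_mult_distrib S_number_mult)
    then show ?thesis using that by blast
  qed
  have D0: "D \<noteq> 0" and C0: "C \<noteq> 0" using CD c by (auto simp: S_number_def)
  obtain m u where mu: "nat \<bar>C\<bar> = m * u" "S_number S u" "\<And>p. p \<in> S \<Longrightarrow> coprime m p"
    using S_free_part[OF S(1) pr, of "nat \<bar>C\<bar>"] C0 by auto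
  have m0: "m > 0" using mu(1) C0 by (auto intro: gr0I)
  define f where "f x = (snd (quotient_of (c / x)), fst (quotient_of (c / x)))" for x
  have key: "x = c * of_int (fst (f x)) / of_int (snd (f x))" "f x \<in> diff_pairs"
      "S_number S (nat \<bar>fst (f x)\<bar>)" "S_number S (nat \<bar>fst (f x) - snd (f x)\<bar>)"
      "\<exists>w. nat \<bar>snd (f x)\<bar> = m * w \<and> S_number S w" if x: "x \<in> X" for x
  proof -
    obtain Z Y where q: "quotient_of (c / x) = (Z, Y)" by (metis surj_pair)
    have Y: "Y > 0" "coprime Z Y" "c / x = of_int Z / of_int Y"
      using q quotient_of_denom_pos quotient_of_coprime quotient_of_div by blast+
    have fx: "f x = (Y, Z)" by (simp add: f_def q)
    obtain n d where nd: "x = of_int n / of_int d" "S_number S (nat \<bar>n\<bar>)" "S_number S (nat \<bar>d\<bar>)"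
      using S_unit_fraction[OF X(2)[OF x]] by metis
    obtain n' d' where nd': "x - c = of_int n' / of_int d'" "S_number S (nat \<bar>n'\<bar>)" "S_number S (nat \<bar>d'\<bar>)"
      using S_unit_fraction[OF X(3)[OF x]] by metis
    have nz: "n \<noteq> 0" "d \<noteq> 0" "n' \<noteq> 0" "d' \<noteq> 0" using nd nd' by (auto simp: S_number_def)
    have x0: "x \<noteq> 0" using nd nz by simp
    have xy0: "x - c \<noteq> 0" using nd' nz by simp
    have cY: "c * of_int Y = x * of_int Z" using Y(1,3) x0 by (simp add: field_simps)
    have Z0: "Z \<noteq> 0" using cY c Y(1) by auto
    show "x = c * of_int (fst (f x)) / of_int (snd (f x))" using cY Z0 by (simp add: fx field_simps)
    have "Y \<noteq> Z" using cY xy0 Y(1) by auto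
    then show "f x \<in> diff_pairs" using Y Z0 by (simp add: fx diff_pairs_def coprime_commute)
    have "of_int (Y * (n' * d)) = (of_int ((Y - Z) * (n * d')) :: rat)"
    proof -
      have "(x - c) * of_int Y = x * of_int (Y - Z)" using cY by (simp add: algebra_simps)
      then have "of_int n' / of_int d' * of_int Y = of_int n / of_int d * (of_int (Y - Z) :: rat)"
        by (simp only: nd(1)[symmetric] nd'(1)[symmetric])
      then show ?thesis using nz by (simp add: field_simps)
    qed
    then have "Y * (n' * d) = (Y - Z) * (n * d')" by (simp only: of_int_eq_iff)
    then have e: "nat \<bar>Y\<bar> * (nat \<bar>n'\<bar> * nat \<bar>d\<bar>) = nat \<bar>Y - Z\<bar> * (nat \<bar>n\<bar> * nat \<bar>d'\<bar>)"
      by (metis nat_abs_mult_distrib)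
    have cop: "coprime (nat \<bar>Y\<bar>) (nat \<bar>Y - Z\<bar>)"
      using coprime_diff_self[of Y Z] Y(2) coprime_minus_right_iff[of Y "Y - Z"]
      by (simp add: coprime_commute)
    have sn: "S_number S (nat \<bar>n'\<bar> * nat \<bar>d\<bar>)" "S_number S (nat \<bar>n\<bar> * nat \<bar>d'\<bar>)"
      using nd nd' by (auto intro: S_number_mult)
    have sY: "S_number S (nat \<bar>Y\<bar>)"
      using S_number_cofactor[OF sn e _ cop] Y(1) by simp
    moreover have "S_number S (nat \<bar>Y - Z\<bar>)"
      using S_number_cofactor[OF sn(2,1) e[symmetric] _ cop[THEN coprime_commute[THEN iffD1]]] \<open>Y \<noteq> Z\<close> by simp
    ultimately show "S_number S (nat \<bar>fst (f x)\<bar>)" "S_number S (nat \<bar>fst (f x) - snd (f x)\<bar>)"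
      by (auto simp: fx)
    have "of_int (Z * (D * n)) = (of_int (C * (d * Y)) :: rat)"
      using cY nz D0 unfolding nd(1) CD(1) by (simp add: field_simps)
    then have "Z * (D * n) = C * (d * Y)" by (simp only: of_int_eq_iff)
    then have ZC: "nat \<bar>Z\<bar> * (nat \<bar>D\<bar> * nat \<bar>n\<bar>) = m * u * (nat \<bar>d\<bar> * nat \<bar>Y\<bar>)"
      by (metis nat_abs_mult_distrib mu(1))
    have sA: "S_number S (nat \<bar>D\<bar> * nat \<bar>n\<bar>)" using CD nd by (auto intro: S_number_mult)
    have "coprime m (nat \<bar>D\<bar> * nat \<bar>n\<bar>)"
    proof (rule ccontr)
      assume "\<not> coprime m (nat \<bar>D\<bar> * nat \<bar>n\<bar>)"
      then obtain p where p: "prime p" "p dvd m" "p dvd nat \<bar>D\<bar> * nat \<bar>n\<bar>"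
        using prime_factor_nat[of "gcd m (nat \<bar>D\<bar> * nat \<bar>n\<bar>)"]
        by (auto simp: coprime_iff_gcd_eq_1)
      then have "coprime m p" using sA mu(3) by (auto simp: S_number_def)
      then show False using p by (metis coprime_absorb_right coprime_commute not_prime_unit)
    qed
    moreover have "m dvd nat \<bar>Z\<bar> * (nat \<bar>D\<bar> * nat \<bar>n\<bar>)" unfolding ZC by simp
    ultimately have "m dvd nat \<bar>Z\<bar>" by (simp add: coprime_dvd_mult_left_iff)
    then obtain w where w: "nat \<bar>Z\<bar> = m * w" by blast
    have "m * (w * (nat \<bar>D\<bar> * nat \<bar>n\<bar>)) = m * (u * (nat \<bar>d\<bar> * nat \<bar>Y\<bar>))"
      using ZC unfolding w by (simp only: mult.assoc)
    then have e': "w * (nat \<bar>D\<bar> * nat \<bar>n\<bar>) = 1 * (u * (nat \<bar>d\<bar> * nat \<bar>Y\<bar>))"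
      by (simp only: nat_mult_eq_cancel1[OF m0] mult_1_left)
    have "w > 0" using w Z0 by (auto intro: gr0I)
    moreover have "S_number S (u * (nat \<bar>d\<bar> * nat \<bar>Y\<bar>))"
      using mu(2) nd(3) sY by (intro S_number_mult)
    ultimately have "S_number S w" using S_number_cofactor[OF sA _ e' _ coprime_1_right] by blast
    with w show "\<exists>w. nat \<bar>snd (f x)\<bar> = m * w \<and> S_number S w" unfolding fx snd_conv by blast
  qed
  have "inj_on f X" using key(1) by (intro inj_onI) metis
  then have "card X = card (f ` X)" by (simp add: card_image)
  also have "\<dots> \<le> 2 ^ (16 * (card S + 1))"
  proof (rule card_diff_pairs_le[OF S(1,2) pr m0 mu(3)])
    show "f ` X \<subseteq> diff_pairs" using key(2) by blast
    show "S_number S (nat \<bar>a\<bar>) \<and> S_number S (nat \<bar>a - b\<bar>) \<and> (\<exists>w. nat \<bar>b\<bar> = m * w \<and> S_number S w)"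
      if "(a, b) \<in> f ` X" for a b
    proof -
      from that obtain x where x: "x \<in> X" "f x = (a, b)" by (metis imageE)
      show ?thesis using key(3-5)[OF x(1)] by (simp add: x(2))
    qed
  qed (use X in auto)
  finally show ?thesis .
qed simp

section \<open>Components of the complement and representations\<close>

text \<open>
  In a symmetric digraph the maximal connected subgraphs are strongly connected components, for
  which the library provides disjointness and closure under mutual reachability.
\<close>
lemma (in sym_digraph) max_connected_in_sccs:
  assumes "max_subgraph Digraph_Component.connected C"
  shows "C \<in> sccs"
proof -
  have "arc_mono (Digraph_Component.connected :: ('a, 'b) pre_digraph \<Rightarrow> bool)"
    unfolding arc_mono_def
  proof (intro allI impI, elim conjE)
    fix H1 H2 :: "('a, 'b) pre_digraph"
    assume conn: "Digraph_Component.connected H1" and H: "subgraph H1 H2" "verts H1 = verts H2"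
    have "wf_digraph H2" using H(1) by (simp add: subgraph_def)
    moreover have "spanning H1 H2" using H by (simp add: spanning_def)
    ultimately show "Digraph_Component.connected H2"
      using conn by (rule wf_digraph.connected_spanning_imp_connected)
  qed
  with assms have ind: "induced_subgraph C G" by (rule induced_subgraphI_arc_mono)
  then have C: "wf_digraph C" "Digraph_Component.connected C"
    using assms by (simp_all add: max_subgraph_def subgraph_def)
  have "symmetric C" using sym_arcs ind by (rule induced_graph_imp_symmetric)
  with C have sc: "strongly_connected C"
    by (simp add: wf_digraph.symmetric_connected_imp_strongly_connected)
  show ?thesis
  proof (rule in_sccsI[OF ind sc], rule notI, elim exE conjE)
    fix H assume H: "induced_subgraph H G" "strongly_connected H" "verts C \<subset> verts H"
    then interpret H: wf_digraph H by (auto simp: induced_subgraph_def subgraph_def)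
    have "Digraph_Component.connected H"
      unfolding Digraph_Component.connected_def
    proof (rule strongly_connectedI)
      show "verts (with_proj (mk_symmetric H)) \<noteq> {}" using H(2) by (auto simp: strongly_connected_def)
      fix u v assume "u \<in> verts (with_proj (mk_symmetric H))" "v \<in> verts (with_proj (mk_symmetric H))"
      then have "u \<rightarrow>\<^sup>*\<^bsub>H\<^esub> v" using H(2) by (simp add: strongly_connected_def)
      then show "u \<rightarrow>\<^sup>*\<^bsub>with_proj (mk_symmetric H)\<^esub> v" by (rule H.reachable_mk_symmetricI)
    qed
    moreover have "subgraph C H"
    proof -
      have arcs: "arcs C = {e \<in> arcs G. tail G e \<in> verts C \<and> head G e \<in> verts C}"
        "arcs H = {e \<in> arcs G. tail G e \<in> verts H \<and> head G e \<in> verts H}"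
        using ind H(1) unfolding induced_subgraph_def by blast+
      have "compatible G C" "compatible G H"
        using ind H(1) unfolding induced_subgraph_def subgraph_def by blast+
      then have "compatible H C" unfolding compatible_def by metis
      moreover have "arcs C \<subseteq> arcs H" "verts C \<subseteq> verts H" unfolding arcs using H(3) by blast+
      ultimately show ?thesis
        unfolding subgraph_def using C(1) H.wf_digraph_axioms by blast
    qed
    moreover have "subgraph H G" using H(1) unfolding induced_subgraph_def by blast
    moreover have "H \<noteq> C" using H(3) by blast
    ultimately show False using assms unfolding max_subgraph_def by blast
  qed
qed

lemma
  fixes G :: "'v pair_pre_digraph"
  assumes "pair_graph G" "C \<in> connected_components (with_proj (complement_graph G))"
  shows connected_component_verts: "verts C \<subseteq> pverts G" "verts C \<noteq> {}"
    and adjacent_outside_component: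
      "u \<in> verts C \<Longrightarrow> v \<in> pverts G \<Longrightarrow> v \<notin> verts C \<Longrightarrow> (v, u) \<in> parcs G"
    and connected_components_disjoint:
      "D \<in> connected_components (with_proj (complement_graph G)) \<Longrightarrow> C \<noteq> D \<Longrightarrow> verts C \<inter> verts D = {}"
proof -
  interpret H: pair_graph "complement_graph G" by (rule pair_graph_complement_graph[OF assms(1)])
  have scc: "D \<in> H.sccs" if "D \<in> connected_components (with_proj (complement_graph G))" for D
    using that H.max_connected_in_sccs by (simp add: connected_components_def)
  have C: "C \<in> H.sccs" using assms(2) by (rule scc)
  then have V: "verts C \<in> H.sccs_verts" by (intro H.in_sccs_vertsI_sccs) auto
  have pv: "pverts (complement_graph G) = pverts G" by (simp add: complement_graph_def)
  show sub: "verts C \<subseteq> pverts G" "verts C \<noteq> {}"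
    using C by (auto simp: H.sccs_def induced_subgraph_def subgraph_def strongly_connected_def pv)
  show "verts C \<inter> verts D = {}"
    if "D \<in> connected_components (with_proj (complement_graph G))" "C \<noteq> D"
    using H.scc_disj[OF C scc] that by auto
  show "(v, u) \<in> parcs G" if u: "u \<in> verts C" and v: "v \<in> pverts G" "v \<notin> verts C"
  proof (rule ccontr)
    assume "(v, u) \<notin> parcs G"
    then have vu: "(v, u) \<in> parcs (complement_graph G)"
      using u v sub by (auto simp: complement_graph_def)
    then have "v \<rightarrow>\<^sup>*\<^bsub>with_proj (complement_graph G)\<^esub> u" by (intro H.reachable_adjI) simp
    moreover from this have "u \<rightarrow>\<^sup>*\<^bsub>with_proj (complement_graph G)\<^esub> v"
      by (rule H.symmetric_reachable')
    ultimately show False using V u v by (auto simp: H.sccs_verts_def)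
  qed
qed

lemma representable_with_imp_embedding:
  assumes "representable_with G S"
  obtains \<phi> where "inj_on \<phi> (pverts G)"
    and "\<And>u v. (u, v) \<in> parcs G \<Longrightarrow> \<phi> u - \<phi> v \<in> S_units S"
proof -
  from assms obtain A hom where
    hom: "pre_digraph.digraph_isomorphism (with_proj G) hom"
    and H: "with_proj (S_graph S A) = app_iso hom (with_proj G)"
    by (auto simp: representable_with_def digraph_iso_def)
  have fields: "parcs (S_graph S A) = iso_arcs hom ` parcs G" "fst = iso_tail hom" "snd = iso_head hom"
    using arg_cong[OF H, of arcs] arg_cong[OF H, of tail] arg_cong[OF H, of head] by simp_all
  have "iso_verts hom u - iso_verts hom v \<in> S_units S" if "(u, v) \<in> parcs G" for u v
  proof -
    have "iso_tail hom (iso_arcs hom (u, v)) = iso_verts hom u"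
      "iso_head hom (iso_arcs hom (u, v)) = iso_verts hom v"
      using hom that by (auto simp: pre_digraph.digraph_isomorphism_def)
    then have "iso_arcs hom (u, v) = (iso_verts hom u, iso_verts hom v)"
      by (simp add: fields(2,3)[symmetric] prod_eq_iff)
    moreover have "iso_arcs hom (u, v) \<in> parcs (S_graph S A)" using that fields by auto
    ultimately show ?thesis by (auto simp: S_graph_def)
  qed
  moreover have "inj_on (iso_verts hom) (pverts G)"
    using hom by (simp add: pre_digraph.digraph_isomorphism_def)
  ultimately show ?thesis by (rule that[rotated])
qed

lemma card_common_neighbours_le:
  assumes S: "finite S" "S \<noteq> {}" "\<forall>p\<in>S. prime p"
    and \<phi>: "inj_on \<phi> V" "finite V" and ab: "a \<in> V" "b \<in> V" "a \<noteq> b"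
    and W: "W \<subseteq> V" "\<And>v. v \<in> W \<Longrightarrow> \<phi> v - \<phi> a \<in> S_units S" "\<And>v. v \<in> W \<Longrightarrow> \<phi> v - \<phi> b \<in> S_units S"
  shows "card W \<le> 2 ^ (16 * (card S + 1))"
proof -
  have inj: "inj_on (\<lambda>v. \<phi> v - \<phi> a) W"
    using inj_on_subset[OF \<phi>(1) W(1)] by (auto simp: inj_on_def)
  have "card ((\<lambda>v. \<phi> v - \<phi> a) ` W) \<le> 2 ^ (16 * (card S + 1))"
  proof (rule card_S_unit_solutions_le[OF S])
    show "\<phi> b - \<phi> a \<noteq> 0" using \<phi>(1) ab by (auto dest: inj_onD)
  qed (use W finite_subset[OF W(1) \<phi>(2)] in auto)
  then show ?thesis by (simp add: card_image[OF inj])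
qed

text \<open>
  Choosing the two vertices in different components bounds what lies outside both, and choosing
  them in one component of order at least two bounds what lies outside that component.
  Disjointness of the components makes these sets cover all vertices.
\<close>
theorem theorem5p5:
  fixes S :: "nat set" and G :: "'v pair_pre_digraph" and k :: nat
  assumes "finite S" and "S \<noteq> {}" and "\<forall>p \<in> S. prime p"
    and "pair_graph G" and "card (pverts G) = k"
    and "card (connected_components (with_proj (complement_graph G))) \<ge> 3 \<or>
         (\<exists>C \<in> connected_components (with_proj (complement_graph G)).
          \<exists>D \<in> connected_components (with_proj (complement_graph G)).
            C \<noteq> D \<and> card (verts C) \<ge> 2 \<and> card (verts D) \<ge> 2)"
    and "k > 3 * 2 ^ (16 * (card S + 1))"
  shows "\<not> representable_with G S"
proof
  assume "representable_with G S"
  then obtain \<phi> where inj: "inj_on \<phi> (pverts G)"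
    and unit: "\<And>u v. (u, v) \<in> parcs G \<Longrightarrow> \<phi> u - \<phi> v \<in> S_units S"
    by (rule representable_with_imp_embedding) blast
  interpret G: pair_graph G by fact
  let ?V = "pverts G" and ?K = "connected_components (with_proj (complement_graph G))"
  define N where "N = (2::nat) ^ (16 * (card S + 1))"
  note verts = connected_component_verts[OF \<open>pair_graph G\<close>]
  note adj = adjacent_outside_component[OF \<open>pair_graph G\<close>]
  note disj = connected_components_disjoint[OF \<open>pair_graph G\<close>]
  have fin: "finite ?V" by (rule G.pair_finite_verts)
  have bound: "card (?V - verts C - verts D) \<le> N"
    if "C \<in> ?K" "D \<in> ?K" "a \<in> verts C" "b \<in> verts D" "a \<noteq> b" for C D a b
    unfolding N_def
  proof (rule card_common_neighbours_le[OF assms(1-3) inj fin])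
    show "a \<in> ?V" "b \<in> ?V" using verts that by blast+
    show "\<phi> v - \<phi> a \<in> S_units S" "\<phi> v - \<phi> b \<in> S_units S" if v: "v \<in> ?V - verts C - verts D" for v
      using adj[of C a v] adj[of D b v] v \<open>C \<in> ?K\<close> \<open>D \<in> ?K\<close> \<open>a \<in> verts C\<close> \<open>b \<in> verts D\<close>
      by (auto intro: unit)
  qed (use that in auto)
  from assms(6) have "card ?V \<le> 3 * N"
  proof
    assume "3 \<le> card ?K"
    then obtain T where "T \<subseteq> ?K" "card T = 3" by (meson obtain_subset_with_card_n)
    then obtain C D E where CDE: "C \<in> ?K" "D \<in> ?K" "E \<in> ?K" "C \<noteq> D" "C \<noteq> E" "D \<noteq> E"
      by (auto simp: card_3_iff)
    then have dis: "verts C \<inter> verts D = {}" "verts C \<inter> verts E = {}" "verts D \<inter> verts E = {}"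
      using disj by blast+
    obtain c d e where cde: "c \<in> verts C" "d \<in> verts D" "e \<in> verts E"
      using verts CDE by (meson ex_in_conv)
    have "?V \<subseteq> (?V - verts C - verts D) \<union> (?V - verts C - verts E) \<union> (?V - verts D - verts E)"
      using dis by blast
    then have "card ?V \<le> card ((?V - verts C - verts D) \<union> (?V - verts C - verts E) \<union> (?V - verts D - verts E))"
      using fin by (intro card_mono) auto
    also have "\<dots> \<le> card (?V - verts C - verts D) + card (?V - verts C - verts E) + card (?V - verts D - verts E)"
      by (meson card_Un_le add_right_mono order_trans)
    also have "\<dots> \<le> N + N + N"
      using CDE cde dis by (intro add_mono bound[of C D c d] bound[of C E c e] bound[of D E d e]) auto
    finally show ?thesis by simp
  next
    assume "\<exists>C\<in>?K. \<exists>D\<in>?K. C \<noteq> D \<and> 2 \<le> card (verts C) \<and> 2 \<le> card (verts D)"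
    then obtain C D where CD: "C \<in> ?K" "D \<in> ?K" "C \<noteq> D" "2 \<le> card (verts C)" "2 \<le> card (verts D)"
      by blast
    have two: "card (?V - verts C) \<le> N" if "C \<in> ?K" "2 \<le> card (verts C)" for C
    proof -
      obtain T where "T \<subseteq> verts C" "card T = 2" using \<open>2 \<le> card (verts C)\<close> by (meson obtain_subset_with_card_n)
      then obtain a b where "a \<in> verts C" "b \<in> verts C" "a \<noteq> b" by (auto simp: card_2_iff)
      then show ?thesis using bound[of C C a b] \<open>C \<in> ?K\<close> by (simp add: Diff_idemp)
    qed
    have "?V \<subseteq> (?V - verts C) \<union> (?V - verts D)" using disj CD by blast
    then have "card ?V \<le> card ((?V - verts C) \<union> (?V - verts D))" using fin by (intro card_mono) auto
    also have "\<dots> \<le> card (?V - verts C) + card (?V - verts D)" by (rule card_Un_le)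
    also have "\<dots> \<le> N + N" using CD two by (intro add_mono) auto
    finally show ?thesis by simp
  qed
  with assms(5,7) show False by (simp add: N_def)
qed

end
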